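(* Let $\mathcal{G}=(A,(\preceq_i)_{i\in\mathcal{P}})$ be a game whose preference relations are all $\omega$-recognizable total preorders. Then from every initial vertex there exists a Nash equilibrium.
   Context: An arena is $A=(V,E,\mathcal{P},(V_i)_i)$ with finite vertex set $V$, edges $E$ (every vertex has a successor), finite player set $\mathcal{P}$ and partition $(V_i)_i$. A relation on $V^\omega$ is $\omega$-recognizable if it equals $\bigcup_k X_k\times Y_k$ with $X_k,Y_k$ $\omega$-regular; a total preorder is reflexive, transitive, and any two words are comparable. Let $x\prec_i y$ iff $x\preceq_i y$ and $y\not\preceq_i x$. A Nash equilibrium from $v_0$ is a strategy profile $\sigma$ such that for every player $i$ and every strategy $\tau_i$ of player $i$, $\langle\sigma\rangle_{v_0}\not\prec_i\langle\tau_i,\sigma_{-i}\rangle_{v_0}$, where $\langle\cdot\rangle_{v_0}$ denotes the outcome from $v_0$. *)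

theory Defs
  imports Main
begin

definition omega_words :: "'v set \<Rightarrow> (nat \<Rightarrow> 'v) set" where
  "omega_words V = {w. \<forall>n. w n \<in> V}"

definition buchi_lang ::
  "'v set \<Rightarrow> nat set \<Rightarrow> nat set \<Rightarrow> (nat \<times> 'v \<times> nat) set \<Rightarrow> nat set \<Rightarrow> (nat \<Rightarrow> 'v) set" where
  "buchi_lang V Q Q0 \<delta> F =
     {w \<in> omega_words V. \<exists>r. r 0 \<in> Q0 \<and> (\<forall>n. r n \<in> Q \<and> (r n, w n, r (Suc n)) \<in> \<delta>)
                             \<and> (\<exists>\<^sub>\<infinity>n. r n \<in> F)}"

definition omega_regular :: "'v set \<Rightarrow> (nat \<Rightarrow> 'v) set \<Rightarrow> bool" where
  "omega_regular V L \<longleftrightarrow>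
     (\<exists>Q Q0 \<delta> F. finite Q \<and> Q0 \<subseteq> Q \<and> F \<subseteq> Q \<and> \<delta> \<subseteq> Q \<times> V \<times> Q \<and> L = buchi_lang V Q Q0 \<delta> F)"

definition omega_recognizable :: "'v set \<Rightarrow> ((nat \<Rightarrow> 'v) \<times> (nat \<Rightarrow> 'v)) set \<Rightarrow> bool" where
  "omega_recognizable V R \<longleftrightarrow>
     (\<exists>n X Y. (\<forall>k<n. omega_regular V (X k) \<and> omega_regular V (Y k))
             \<and> R = (\<Union>k<(n::nat). X k \<times> Y k))"

definition total_preorder_on :: "'a set \<Rightarrow> ('a \<times> 'a) set \<Rightarrow> bool" where
  "total_preorder_on W R \<longleftrightarrow>
     (\<forall>x\<in>W. (x, x) \<in> R) \<and>
     (\<forall>x y z. (x, y) \<in> R \<longrightarrow> (y, z) \<in> R \<longrightarrow> (x, z) \<in> R) \<and>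
     (\<forall>x\<in>W. \<forall>y\<in>W. (x, y) \<in> R \<or> (y, x) \<in> R)"

text \<open>Arena: finite vertex set V, edge relation E on V in which every vertex has a successor,
  finite player set P, and the partition (V_i)_i given by an owner function:
  V_i = {v \<in> V. owner v = i}.\<close>

definition arena :: "'v set \<Rightarrow> ('v \<times> 'v) set \<Rightarrow> 'p set \<Rightarrow> ('v \<Rightarrow> 'p) \<Rightarrow> bool" where
  "arena V E P owner \<longleftrightarrow> finite V \<and> finite P \<and> E \<subseteq> V \<times> V \<and>
     (\<forall>v\<in>V. \<exists>u. (v, u) \<in> E) \<and> (\<forall>v\<in>V. owner v \<in> P)"

definition history :: "'v set \<Rightarrow> ('v \<times> 'v) set \<Rightarrow> 'v list \<Rightarrow> bool" where
  "history V E h \<longleftrightarrow> h \<noteq> [] \<and> set h \<subseteq> V \<and> (\<forall>k. Suc k < length h \<longrightarrow> (h ! k, h ! Suc k) \<in> E)"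

definition strategy :: "'v set \<Rightarrow> ('v \<times> 'v) set \<Rightarrow> ('v \<Rightarrow> 'p) \<Rightarrow> 'p \<Rightarrow> ('v list \<Rightarrow> 'v) \<Rightarrow> bool" where
  "strategy V E owner i \<sigma> \<longleftrightarrow>
     (\<forall>h. history V E h \<longrightarrow> owner (last h) = i \<longrightarrow> (last h, \<sigma> h) \<in> E)"

definition strategy_profile ::
  "'v set \<Rightarrow> ('v \<times> 'v) set \<Rightarrow> 'p set \<Rightarrow> ('v \<Rightarrow> 'p) \<Rightarrow> ('p \<Rightarrow> 'v list \<Rightarrow> 'v) \<Rightarrow> bool" where
  "strategy_profile V E P owner \<sigma> \<longleftrightarrow> (\<forall>i\<in>P. strategy V E owner i (\<sigma> i))"

fun out_hist :: "('v \<Rightarrow> 'p) \<Rightarrow> ('p \<Rightarrow> 'v list \<Rightarrow> 'v) \<Rightarrow> 'v \<Rightarrow> nat \<Rightarrow> 'v list" where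
  "out_hist owner \<sigma> v0 0 = [v0]"
| "out_hist owner \<sigma> v0 (Suc n) =
     (let h = out_hist owner \<sigma> v0 n in h @ [\<sigma> (owner (last h)) h])"

definition outcome :: "('v \<Rightarrow> 'p) \<Rightarrow> ('p \<Rightarrow> 'v list \<Rightarrow> 'v) \<Rightarrow> 'v \<Rightarrow> (nat \<Rightarrow> 'v)" where
  "outcome owner \<sigma> v0 = (\<lambda>n. last (out_hist owner \<sigma> v0 n))"

definition strict_pref :: "('a \<times> 'a) set \<Rightarrow> 'a \<Rightarrow> 'a \<Rightarrow> bool" where
  "strict_pref R x y \<longleftrightarrow> (x, y) \<in> R \<and> (y, x) \<notin> R"

definition nash_equilibrium ::
  "'v set \<Rightarrow> ('v \<times> 'v) set \<Rightarrow> 'p set \<Rightarrow> ('v \<Rightarrow> 'p) \<Rightarrow> ('p \<Rightarrow> ((nat \<Rightarrow> 'v) \<times> (nat \<Rightarrow> 'v)) set)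
   \<Rightarrow> 'v \<Rightarrow> ('p \<Rightarrow> 'v list \<Rightarrow> 'v) \<Rightarrow> bool" where
  "nash_equilibrium V E P owner pref v0 \<sigma> \<longleftrightarrow>
     strategy_profile V E P owner \<sigma> \<and>
     (\<forall>i\<in>P. \<forall>\<tau>. strategy V E owner i \<tau> \<longrightarrow>
        \<not> strict_pref (pref i) (outcome owner \<sigma> v0) (outcome owner (\<sigma>(i := \<tau>)) v0))"

end

theory Submission
  imports Defs "HOL-Library.Ramsey"
begin

text \<open>An \<open>\<omega>\<close>-recognizable total preorder has only finitely many upper sets, so the preferences of each
  player are given by a bounded integer payoff whose superlevel sets are \<open>\<omega>\<close>-regular. Such sets
  are \<open>\<Sigma>\<^sup>0\<^sub>3\<close>, hence by Davis' theorem every history has, for every player, a value that the player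
  can guarantee and the coalition of the others can prevent from being exceeded. In an equilibrium a play
  is followed that gives each player at least the value of each of its prefixes, and whoever
  leaves it first is held down to that value by the others.\<close>

section \<open>Determinacy of \<open>\<Sigma>\<^sup>0\<^sub>3\<close> games\<close>

text \<open>Payoffs may depend on the whole word, so values belong to histories, not to vertices,
  and the value of a player can rise when the others move. Optimal play by everyone from the initial
  vertex is therefore not enough: it secures only the initial values, while a late deviator is held
  only to the value reached at that point. This is why the equilibrium play must be compared with
  the values at all its prefixes. Punishing one player is a two-player game, since all others can
  share one common strategy. Its determinacy is taken at the topological level, with strategies of
  unbounded memory, so a nondeterministic automaton only has to be shown to define a Sigma^0_3 set;
  Ramsey's theorem on segments of words does this directly.\<close>

definition pre :: "(nat \<Rightarrow> 'v) \<Rightarrow> nat \<Rightarrow> 'v list" where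
  "pre x n = map x [0..<n]"

lemma length_pre [simp]: "length (pre x n) = n"
  by (simp add: pre_def)

lemma pre_0 [simp]: "pre x 0 = []"
  by (simp add: pre_def)

lemma pre_Suc: "pre x (Suc n) = pre x n @ [x n]"
  by (simp add: pre_def)

lemma take_pre: "take k (pre x n) = pre x (min k n)"
  by (auto simp: pre_def take_map min_def)

lemma nth_pre: "k < n \<Longrightarrow> pre x n ! k = x k"
  by (simp add: pre_def)

lemma pre_eq_iff: "pre x n = pre y n \<longleftrightarrow> (\<forall>k<n. x k = y k)"
  by (auto simp: pre_def)

lemma pre_eq_mono: "pre x n = pre y n \<Longrightarrow> k \<le> n \<Longrightarrow> pre x k = pre y k"
  by (simp add: pre_eq_iff)

definition plays :: "('v list \<Rightarrow> 'v set) \<Rightarrow> 'v list \<Rightarrow> (nat \<Rightarrow> 'v) set" where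
  "plays M p = {x. pre x (length p) = p \<and> (\<forall>n\<ge>length p. x n \<in> M (pre x n))}"

text \<open>\<open>I\<close> marks the histories at which the owner of the strategy moves. Negating
  \<open>I\<close> gives the opponent, so one notion serves both sides and, later, a
  coalition.\<close>

definition follows :: "('v list \<Rightarrow> bool) \<Rightarrow> ('v list \<Rightarrow> 'v) \<Rightarrow> 'v list \<Rightarrow> (nat \<Rightarrow> 'v) \<Rightarrow> bool" where
  "follows I \<sigma> p x \<longleftrightarrow> (\<forall>n\<ge>length p. I (pre x n) \<longrightarrow> x n = \<sigma> (pre x n))"

text \<open>Legality is demanded at every history: each strategy then generates a play, so winning
  is never vacuous.\<close>

definition wins ::
  "('v list \<Rightarrow> bool) \<Rightarrow> ('v list \<Rightarrow> 'v set) \<Rightarrow> 'v list \<Rightarrow> (nat \<Rightarrow> 'v) set \<Rightarrow> bool" where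
  "wins I M p A \<longleftrightarrow> (\<exists>\<sigma>. (\<forall>h. \<sigma> h \<in> M h) \<and> (\<forall>x\<in>plays M p. follows I \<sigma> p x \<longrightarrow> x \<in> A))"

text \<open>\<open>M'\<close> is a quasi-strategy of the opponent: only moves outside
  \<open>I\<close> are thinned out, and never to nothing.\<close>

definition restricts ::
  "('v list \<Rightarrow> bool) \<Rightarrow> ('v list \<Rightarrow> 'v set) \<Rightarrow> ('v list \<Rightarrow> 'v set) \<Rightarrow> bool" where
  "restricts I M' M \<longleftrightarrow> (\<forall>h. M' h \<noteq> {} \<and> M' h \<subseteq> M h \<and> (I h \<longrightarrow> M' h = M h))"

lemma restricts_trans: "restricts I M'' M' \<Longrightarrow> restricts I M' M \<Longrightarrow> restricts I M'' M"
  by (fastforce simp: restricts_def)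

lemma plays_pre: "x \<in> plays M p \<Longrightarrow> pre x (length p) = p"
  by (simp add: plays_def)

lemma plays_later: "x \<in> plays M p \<Longrightarrow> length p \<le> n \<Longrightarrow> x \<in> plays M (pre x n)"
  by (simp add: plays_def)

lemma plays_graft:
  assumes "x \<in> plays M p" "length p \<le> n" "y \<in> plays M (pre x n)"
  shows "y \<in> plays M p"
proof -
  have eq: "pre y n = pre x n" using assms(3) by (simp add: plays_def)
  have "y k \<in> M (pre y k)" if "length p \<le> k" for k
  proof (cases "n \<le> k")
    case True then show ?thesis using assms(3) by (simp add: plays_def)
  next
    case False
    then have "pre y k = pre x k" "y k = x k"
      using eq by (simp_all add: pre_eq_iff)
    then show ?thesis using assms(1) that by (simp add: plays_def)
  qed
  moreover have "pre y (length p) = p"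
    using pre_eq_mono[OF eq assms(2)] plays_pre[OF assms(1)] by simp
  ultimately show ?thesis by (simp add: plays_def)
qed

lemma follows_graft:
  assumes "follows I \<sigma> p x" "length p \<le> n" "pre y n = pre x n" "follows I \<sigma> (pre x n) y"
  shows "follows I \<sigma> p y"
  unfolding follows_def
proof (intro allI impI)
  fix k assume k: "length p \<le> k" "I (pre y k)"
  show "y k = \<sigma> (pre y k)"
  proof (cases "n \<le> k")
    case True then show ?thesis using assms(4) k by (simp add: follows_def)
  next
    case False
    then have "pre y k = pre x k" "y k = x k"
      using assms(3) by (simp_all add: pre_eq_iff)
    then show ?thesis using assms(1) k by (simp add: follows_def)
  qed
qed

lemma exists_play:
  assumes "\<forall>h. \<sigma> h \<in> M h"
  obtains x where "x \<in> plays M p" "\<forall>n\<ge>length p. x n = \<sigma> (pre x n)"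
proof -
  define H where "H = rec_nat p (\<lambda>_ h. h @ [\<sigma> h])"
  have H0: "H 0 = p" and HS: "H (Suc n) = H n @ [\<sigma> (H n)]" for n by (simp_all add: H_def)
  have len: "length (H n) = length p + n" for n by (induction n) (simp_all add: H0 HS)
  define x where "x k = (if k < length p then p ! k else \<sigma> (H (k - length p)))" for k
  have xp: "pre x (length p) = p"
    by (rule nth_equalityI) (simp_all add: nth_pre x_def)
  have xH: "x (length p + n) = \<sigma> (H n)" for n by (simp add: x_def)
  have pH: "pre x (length p + n) = H n" for n
    by (induction n) (simp_all add: xp H0 HS pre_Suc xH)
  have "x n = \<sigma> (pre x n)" if "n \<ge> length p" for n
    using pH[of "n - length p"] xH[of "n - length p"] that by simp
  then show ?thesis using that[of x] xp assms by (auto simp: plays_def)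
qed

lemma wins_legal: "wins I M p A \<Longrightarrow> M h \<noteq> {}"
  by (auto simp: wins_def)

lemma wins_strategies:
  assumes "\<And>q. q \<in> X \<Longrightarrow> wins I M q (A q)" "\<forall>h. M h \<noteq> {}"
  obtains s where "\<And>q h. s q h \<in> M h"
    "\<And>q x. q \<in> X \<Longrightarrow> x \<in> plays M q \<Longrightarrow> follows I (s q) q x \<Longrightarrow> x \<in> A q"
proof -
  have "\<exists>\<sigma>. (\<forall>h. \<sigma> h \<in> M h) \<and> (q \<in> X \<longrightarrow> (\<forall>x\<in>plays M q. follows I \<sigma> q x \<longrightarrow> x \<in> A q))" for q
  proof (cases "q \<in> X")
    case True then show ?thesis using assms(1) by (auto simp: wins_def)
  next
    case False
    have "\<forall>h. (SOME u. u \<in> M h) \<in> M h" using assms(2) by (simp add: some_in_eq)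
    then show ?thesis using False by (intro exI[of _ "\<lambda>h. SOME u. u \<in> M h"]) simp
  qed
  then have "\<exists>s. \<forall>q. (\<forall>h. s q h \<in> M h) \<and>
      (q \<in> X \<longrightarrow> (\<forall>x\<in>plays M q. follows I (s q) q x \<longrightarrow> x \<in> A q))"
    by (intro choice allI)
  then show ?thesis using that by blast
qed

section \<open>Switching between strategies\<close>

text \<open>At the first prefix in \<open>X\<close>, \<open>\<sigma>\<close> is abandoned for the
  winning strategy of that prefix, which then stays fixed; a play that never meets \<open>X\<close>
  follows \<open>\<sigma>\<close> throughout.\<close>

lemma wins_until:
  assumes X: "\<And>q. q \<in> X \<Longrightarrow> wins I M q A"
    and \<sigma>: "\<forall>h. \<sigma> h \<in> M h"
    and esc: "\<And>x. x \<in> plays M p \<Longrightarrow> follows I \<sigma> p x \<Longrightarrow> \<forall>n\<ge>length p. pre x n \<notin> X \<Longrightarrow> x \<in> A"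
  shows "wins I M p A"
proof -
  from \<sigma> have ne: "\<forall>h. M h \<noteq> {}" by blast
  obtain s where s: "\<And>q h. s q h \<in> M h"
    "\<And>q x. q \<in> X \<Longrightarrow> x \<in> plays M q \<Longrightarrow> follows I (s q) q x \<Longrightarrow> x \<in> A"
    using wins_strategies[where X = X and A = "\<lambda>_. A", OF X ne] by blast
  define hit where "hit h k \<longleftrightarrow> length p \<le> k \<and> k \<le> length h \<and> take k h \<in> X" for h k
  define \<sigma>' where "\<sigma>' h = (if \<exists>k. hit h k then s (take (LEAST k. hit h k) h) h else \<sigma> h)" for h
  have "x \<in> A" if x: "x \<in> plays M p" and f: "follows I \<sigma>' p x" for x
  proof (cases "\<exists>n\<ge>length p. pre x n \<in> X")
    case True
    define n where "n = (LEAST n. length p \<le> n \<and> pre x n \<in> X)"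
    have n: "length p \<le> n" "pre x n \<in> X"
      using LeastI_ex[of "\<lambda>n. length p \<le> n \<and> pre x n \<in> X"] True by (auto simp: n_def)
    have nmin: "n \<le> k" if "length p \<le> k" "pre x k \<in> X" for k
      unfolding n_def by (rule Least_le) (use that in simp)
    have "\<sigma>' (pre x m) = s (pre x n) (pre x m)" if "m \<ge> n" for m
    proof -
      have h: "hit (pre x m) n" using n that by (simp add: hit_def take_pre min_absorb1)
      have "(LEAST k. hit (pre x m) k) = n"
      proof (rule Least_equality)
        fix k assume "hit (pre x m) k"
        then show "n \<le> k" using nmin by (auto simp: hit_def take_pre min_absorb1)
      qed (rule h)
      then show ?thesis using h that by (auto simp: \<sigma>'_def take_pre min_absorb1)
    qed
    then have "follows I (s (pre x n)) (pre x n) x"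
      using f n(1) by (simp add: follows_def)
    then show ?thesis using s(2)[OF n(2)] plays_later[OF x n(1)] by blast
  next
    case False
    then have "\<not> hit (pre x m) k" for m k
      by (auto simp: hit_def take_pre min_absorb1)
    then have "follows I \<sigma> p x" using f by (simp add: follows_def \<sigma>'_def)
    then show ?thesis using esc x False by blast
  qed
  moreover have "\<forall>h. \<sigma>' h \<in> M h" using s(1) \<sigma> by (simp add: \<sigma>'_def)
  ultimately show ?thesis unfolding wins_def by blast
qed

text \<open>The strategy of the most recent visit of \<open>X\<close> is always in force. If the
  visits stop, the last one has been followed ever since without another visit, so it must have
  achieved \<open>A\<close>; otherwise \<open>inf\<close> applies.\<close>

lemma wins_infinitely_often:
  assumes p: "p \<in> X" and ne: "\<forall>h. M h \<noteq> {}"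
    and X: "\<And>q. q \<in> X \<Longrightarrow> wins I M q {x. x \<in> A \<or> (\<exists>n>length q. pre x n \<in> X)}"
    and inf: "\<And>x. \<exists>\<^sub>\<infinity>n. pre x n \<in> X \<Longrightarrow> x \<in> A"
  shows "wins I M p A"
proof -
  obtain s where s: "\<And>q h. s q h \<in> M h"
    "\<And>q x. q \<in> X \<Longrightarrow> x \<in> plays M q \<Longrightarrow> follows I (s q) q x
       \<Longrightarrow> x \<in> {x. x \<in> A \<or> (\<exists>n>length q. pre x n \<in> X)}"
    using wins_strategies[where X = X, OF X ne] by blast
  define \<sigma> where "\<sigma> h = s (take (GREATEST k. k \<le> length h \<and> take k h \<in> X) h) h" for h
  have "x \<in> A" if x: "x \<in> plays M p" and f: "follows I \<sigma> p x" for x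
  proof (rule ccontr)
    assume nA: "x \<notin> A"
    then have "finite {n. pre x n \<in> X}" using inf by (auto simp: INFM_iff_infinite)
    moreover have pX: "length p \<in> {n. pre x n \<in> X}" using p plays_pre[OF x] by simp
    ultimately obtain n where n: "pre x n \<in> X" and nmax: "\<And>m. pre x m \<in> X \<Longrightarrow> m \<le> n"
      using Max_in[of "{n. pre x n \<in> X}"] Max_ge[of "{n. pre x n \<in> X}"] by blast
    have pn: "length p \<le> n" using nmax pX by simp
    have "\<sigma> (pre x m) = s (pre x n) (pre x m)" if "m \<ge> n" for m
    proof -
      have "(GREATEST k. k \<le> length (pre x m) \<and> take k (pre x m) \<in> X) = n"
        by (rule Greatest_equality) (use n that nmax in \<open>auto simp: take_pre min_absorb1\<close>)
      then show ?thesis using that by (simp add: \<sigma>_def take_pre min_absorb1)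
    qed
    then have "follows I (s (pre x n)) (pre x n) x"
      using f pn by (simp add: follows_def)
    then show False using s(2)[OF n plays_later[OF x pn]] nA nmax by force
  qed
  moreover have "\<forall>h. \<sigma> h \<in> M h" using s(1) by (simp add: \<sigma>_def)
  ultimately show ?thesis unfolding wins_def by blast
qed

lemma play_succ:
  assumes "x \<in> plays M p"
  shows "pre x (Suc (length p)) = p @ [x (length p)]" "x (length p) \<in> M p"
  using assms by (auto simp: plays_def pre_Suc)

lemma wins_own_move:
  assumes "I p" "u \<in> M p" "wins I M (p @ [u]) A"
  shows "wins I M p A"
proof -
  have ne: "\<forall>h. M h \<noteq> {}" using wins_legal[OF assms(3)] by blast
  define \<sigma> where "\<sigma> h = (if h = p then u else SOME u. u \<in> M h)" for h
  show ?thesis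
  proof (rule wins_until[where X = "{p @ [u]}" and \<sigma> = \<sigma>])
    show "\<forall>h. \<sigma> h \<in> M h" using ne assms(2) by (simp add: \<sigma>_def some_in_eq)
    fix x assume x: "x \<in> plays M p" "follows I \<sigma> p x" "\<forall>n\<ge>length p. pre x n \<notin> {p @ [u]}"
    have "x (length p) = u" using x assms(1) plays_pre[OF x(1)]
      by (simp add: follows_def \<sigma>_def)
    then show "x \<in> A" using x(3)[rule_format, of "Suc (length p)"] play_succ[OF x(1)] by simp
  qed (use assms in auto)
qed

text \<open>Used contrapositively together with \<open>wins_own_move\<close>: from a position that
  is not won, the player cannot move to a won one, and the opponent can move to one that is not
  won.\<close>

lemma wins_all_moves:
  assumes "\<And>u. u \<in> M p \<Longrightarrow> wins I M (p @ [u]) A" "M p \<noteq> {}"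
  shows "wins I M p A"
proof -
  have ne: "\<forall>h. M h \<noteq> {}" using assms wins_legal by fast
  show ?thesis
  proof (rule wins_until[where X = "{p @ [u] | u. u \<in> M p}" and \<sigma> = "\<lambda>h. SOME u. u \<in> M h"])
    show "\<forall>h. (SOME u. u \<in> M h) \<in> M h" using ne by (simp add: some_in_eq)
    fix x assume x: "x \<in> plays M p" "\<forall>n\<ge>length p. pre x n \<notin> {p @ [u] | u. u \<in> M p}"
    then show "x \<in> A" using x(2)[rule_format, of "Suc (length p)"] play_succ[OF x(1)] by simp
  qed (use assms in auto)
qed

text \<open>The key step of Davis' proof of \<open>\<Sigma>\<^sup>0\<^sub>3\<close> determinacy. From a position without such a restriction
  (\<open>bad\<close> below), the player moving at \<open>I\<close> could force \<open>A\<close> or another bad position in \<open>D\<close>, because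
  otherwise the restrictions available at the first visits of \<open>D\<close> could be glued together. Repeating
  this wins \<open>A\<close>.\<close>

lemma davis:
  assumes ne: "\<forall>h. M h \<noteq> {}"
    and DA: "\<And>x. \<exists>\<^sub>\<infinity>n. pre x n \<in> D \<Longrightarrow> x \<in> A"
    and nw: "\<not> wins I M p A"
  shows "\<exists>M'. restricts I M' M \<and> (\<forall>x\<in>plays M' p. \<not> (\<exists>\<^sub>\<infinity>n. pre x n \<in> D)) \<and> \<not> wins I M' p A"
proof -
  define good where "good p M' \<longleftrightarrow> restricts I M' M \<and>
    (\<forall>x\<in>plays M' p. \<not> (\<exists>\<^sub>\<infinity>n. pre x n \<in> D)) \<and> \<not> wins I M' p A" for p M'
  define bad where "bad p \<longleftrightarrow> (\<forall>M'. \<not> good p M')" for p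
  have claim: "wins I M q {x. x \<in> A \<or> (\<exists>n>length q. pre x n \<in> D \<and> bad (pre x n))}" if "bad q" for q
  proof (rule ccontr)
    \<comment> \<open>The inequality \<open>length q < n\<close> is strict because \<open>q\<close>
      itself may lie in \<open>D\<close> and each round has to make progress. If \<open>Z\<close>
      could not be forced, \<open>q\<close> would turn out to be good.\<close>
    define Z where "Z = {x. x \<in> A \<or> (\<exists>n>length q. pre x n \<in> D \<and> bad (pre x n))}"
    assume "\<not> wins I M q {x. x \<in> A \<or> (\<exists>n>length q. pre x n \<in> D \<and> bad (pre x n))}"
    then have nq: "\<not> wins I M q Z" by (simp add: Z_def)
    define W where "W f = (if bad f then M else SOME M'. good f M')" for f
    have W: "good f (W f)" if "\<not> bad f" for f
      using that someI_ex[of "good f"] by (auto simp: W_def bad_def)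
    have Wr: "restricts I (W f) M" for f
      using W[of f] ne by (cases "bad f") (auto simp: W_def good_def restricts_def)
    define hit where "hit h k \<longleftrightarrow> length q < k \<and> k \<le> length h \<and> take k h \<in> D" for h k
    \<comment> \<open>Until the first visit of \<open>D\<close> after \<open>q\<close> the opponent
      keeps \<open>Z\<close> out of reach by moving in \<open>S\<close>; from that visit on, the
      restriction \<open>W\<close> of the visited position takes over. Where \<open>S\<close> is
      empty, \<open>M\<close> is a default that keeps \<open>M'\<close> nonempty.\<close>
    define S where "S h = {u \<in> M h. \<not> wins I M (h @ [u]) Z}" for h
    define M' where "M' h = (if \<exists>k. hit h k then W (take (LEAST k. hit h k) h) h
      else if I h \<or> S h = {} then M h else S h)" for h
    have r: "restricts I M' M"
      using Wr ne by (auto simp: restricts_def M'_def S_def)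
    have hitpre: "hit (pre x m) k \<longleftrightarrow> length q < k \<and> k \<le> m \<and> pre x k \<in> D" for x m k
      by (auto simp: hit_def take_pre min_absorb1)
    have first: "M' (pre x m) = W (pre x n) (pre x m)"
      if n: "length q < n" "pre x n \<in> D" "\<And>k. length q < k \<Longrightarrow> k < n \<Longrightarrow> pre x k \<notin> D" and "n \<le> m"
      for x n m
    proof -
      have h: "hit (pre x m) n" using that by (simp add: hitpre)
      have "(LEAST k. hit (pre x m) k) = n"
      proof (rule Least_equality)
        fix k assume "hit (pre x m) k"
        then show "n \<le> k" using n(3)[of k] by (auto simp: hitpre not_less[symmetric])
      qed (rule h)
      then show ?thesis using h that by (auto simp: M'_def take_pre min_absorb1)
    qed
    have nonhit: "M' (pre x m) = (if I (pre x m) \<or> S (pre x m) = {} then M (pre x m) else S (pre x m))"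
      if "\<And>k. length q < k \<Longrightarrow> k \<le> m \<Longrightarrow> pre x k \<notin> D" for x m
      using that by (auto simp: M'_def hitpre)
    have Sne: "S h \<noteq> {}" if "\<not> wins I M h Z" for h
      using wins_all_moves[of M h I Z] that ne by (auto simp: S_def)
    have stay: "\<not> wins I M (pre x m) Z"
      if x: "x \<in> plays M' q" and m: "length q \<le> m"
        and D: "\<And>k. length q < k \<Longrightarrow> k < m \<Longrightarrow> pre x k \<notin> D" for x m
      using m D
    proof (induction m rule: dec_induct)
      case base then show ?case using nq plays_pre[OF x] by simp
    next
      case (step m)
      then have IH: "\<not> wins I M (pre x m) Z" by simp
      have xm: "x m \<in> M' (pre x m)" using x step by (simp add: plays_def)
      have M'e: "M' (pre x m) = (if I (pre x m) \<or> S (pre x m) = {} then M (pre x m) else S (pre x m))"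
        by (rule nonhit) (use step in auto)
      show ?case
      proof (cases "I (pre x m)")
        case True
        then show ?thesis using wins_own_move[of I "pre x m" "x m" M Z] xm M'e IH
          by (auto simp: pre_Suc)
      next
        case False
        then have "M' (pre x m) = S (pre x m)" using M'e Sne[OF IH] by simp
        then show ?thesis using xm by (simp add: pre_Suc S_def)
      qed
    qed
    \<comment> \<open>At a bad first visit \<open>Z\<close> would hold already, against
      \<open>stay\<close>; so \<open>W\<close> is a genuine good restriction there.\<close>
    have fgood: "\<not> bad (pre x n)"
      if x: "x \<in> plays M' q" and n: "length q < n" "pre x n \<in> D"
        "\<And>k. length q < k \<Longrightarrow> k < n \<Longrightarrow> pre x k \<notin> D" for x n
    proof
      assume b: "bad (pre x n)"
      have "wins I M (pre x n) Z"
        unfolding wins_def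
      proof (intro exI conjI ballI impI)
        show "\<forall>h. (SOME u. u \<in> M h) \<in> M h" using ne by (simp add: some_in_eq)
        fix y assume "y \<in> plays M (pre x n)"
        then have "pre y n = pre x n" by (simp add: plays_def)
        then show "y \<in> Z" using b n by (auto simp: Z_def)
      qed
      then show False using stay[OF x, of n] n by simp
    qed
    have "good q M'"
      unfolding good_def
    proof (intro conjI ballI)
      show "restricts I M' M" by (rule r)
    next
      fix x assume x: "x \<in> plays M' q"
      show "\<not> (\<exists>\<^sub>\<infinity>n. pre x n \<in> D)"
      proof (cases "\<exists>n>length q. pre x n \<in> D")
        case True
        then obtain n where n: "length q < n" "pre x n \<in> D"
          "\<And>k. length q < k \<Longrightarrow> k < n \<Longrightarrow> pre x k \<notin> D"
          using exists_least_iff[of "\<lambda>n. length q < n \<and> pre x n \<in> D"] by auto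
        have "x m \<in> W (pre x n) (pre x m)" if "n \<le> m" for m
        proof -
          have "x m \<in> M' (pre x m)" using x n(1) that by (simp add: plays_def)
          then show ?thesis using first[OF n that] by simp
        qed
        then have "x \<in> plays (W (pre x n)) (pre x n)" by (simp add: plays_def)
        then show ?thesis using W[OF fgood[OF x n]] by (simp add: good_def)
      next
        case False
        then show ?thesis by (auto simp: INFM_nat)
      qed
    next
      show "\<not> wins I M' q A"
      proof
        assume "wins I M' q A"
        then obtain \<sigma> where \<sigma>: "\<forall>h. \<sigma> h \<in> M' h"
          and win: "\<And>x. x \<in> plays M' q \<Longrightarrow> follows I \<sigma> q x \<Longrightarrow> x \<in> A"
          by (auto simp: wins_def)
        \<comment> \<open>In \<open>M\<close>, \<open>\<sigma>\<close> is used until a position won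
          for \<open>Z\<close> appears. If none does, the play has moved only inside
          \<open>S\<close>; without a visit of \<open>D\<close> it is a play of \<open>M'\<close>
          and lies in \<open>A\<close>, and a visit would let \<open>\<sigma>\<close> win
          \<open>A\<close> inside a good \<open>W\<close>.\<close>
        have "wins I M q Z"
        proof (rule wins_until[where X = "{h. wins I M h Z}" and \<sigma> = \<sigma>])
          show "\<forall>h. \<sigma> h \<in> M h" using \<sigma> r by (auto simp: restricts_def)
        next
          fix x assume x: "x \<in> plays M q" and f: "follows I \<sigma> q x"
            and "\<forall>n\<ge>length q. pre x n \<notin> {h. wins I M h Z}"
          then have nl: "\<And>n. length q \<le> n \<Longrightarrow> \<not> wins I M (pre x n) Z" by simp
          have step: "x m \<in> M' (pre x m)"
            if "length q \<le> m" "\<And>k. length q < k \<Longrightarrow> k \<le> m \<Longrightarrow> pre x k \<notin> D" for m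
          proof -
            have "x m \<in> M (pre x m)" using x that by (simp add: plays_def)
            moreover have "x m \<in> S (pre x m)"
              using calculation nl[of "Suc m"] that by (simp add: S_def pre_Suc)
            ultimately show ?thesis using nonhit[OF that(2)] by auto
          qed
          have noD: "pre x n \<notin> D" if qn: "length q < n" for n
          proof
            assume "pre x n \<in> D"
            then obtain n where n: "length q < n" "pre x n \<in> D"
              "\<And>k. length q < k \<Longrightarrow> k < n \<Longrightarrow> pre x k \<notin> D"
              using qn exists_least_iff[of "\<lambda>n. length q < n \<and> pre x n \<in> D"] by auto
            \<comment> \<open>\<open>x\<close> may leave \<open>M'\<close> after step
              \<open>n\<close>, so \<open>fgood\<close> is applied to another play \<open>y\<close>
              through the same prefix.\<close>
            obtain y where y: "y \<in> plays M' (pre x n)" "\<forall>k\<ge>n. y k = \<sigma> (pre y k)"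
              using exists_play[OF \<sigma>, of "pre x n"] by auto
            have yx: "pre y n = pre x n" using plays_pre[OF y(1)] by simp
            have graft: "z \<in> plays M' q" if z: "z \<in> plays M' (pre x n)" for z
            proof -
              have zx: "pre z n = pre x n" using plays_pre[OF z] by simp
              have "z k \<in> M' (pre z k)" if "length q \<le> k" for k
              proof (cases "n \<le> k")
                case True then show ?thesis using z by (simp add: plays_def)
              next
                case False
                then have "pre z k = pre x k" "z k = x k" using zx by (simp_all add: pre_eq_iff)
                then show ?thesis using step[OF that] n(3) False by simp
              qed
              then show ?thesis using pre_eq_mono[OF zx, of "length q"] n(1) plays_pre[OF x]
                by (simp add: plays_def)
            qed
            have "wins I (W (pre x n)) (pre x n) A"
              unfolding wins_def
            proof (intro exI conjI ballI impI)
              \<comment> \<open>The moves of \<open>\<sigma>\<close> are known to be legal for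
                \<open>W (pre x n)\<close> only beyond \<open>pre x n\<close>; elsewhere any legal
                move does.\<close>
              define \<sigma>' where "\<sigma>' h = (if take n h = pre x n \<and> n \<le> length h then \<sigma> h
                else SOME u. u \<in> W (pre x n) h)" for h
              show "\<forall>h. \<sigma>' h \<in> W (pre x n) h"
              proof
                fix h
                show "\<sigma>' h \<in> W (pre x n) h"
                proof (cases "take n h = pre x n \<and> n \<le> length h")
                  case True
                  \<comment> \<open>\<open>first\<close> speaks of infinite words; the tail put
                    after \<open>h\<close> is arbitrary.\<close>
                  define z where "z k = (if k < length h then h ! k else x k)" for k
                  have zh: "pre z (length h) = h"
                    by (rule nth_equalityI) (auto simp: nth_pre z_def)
                  have zn: "pre z n = pre x n"
                    using True zh take_pre[of n z "length h"] by (simp add: min_absorb1)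
                  have "M' (pre z (length h)) = W (pre z n) (pre z (length h))"
                  proof (rule first)
                    fix k assume k: "length q < k" "k < n"
                    then have "pre z k = pre x k" using pre_eq_mono[OF zn, of k] by simp
                    then show "pre z k \<notin> D" using n(3) k by simp
                  qed (use n zn True in auto)
                  then show ?thesis using True \<sigma> zh zn by (auto simp: \<sigma>'_def)
                next
                  case False
                  then show ?thesis using Wr[of "pre x n"] by (auto simp: \<sigma>'_def some_in_eq restricts_def)
                qed
              qed
              fix z assume z: "z \<in> plays (W (pre x n)) (pre x n)"
                and fz: "follows I \<sigma>' (pre x n) z"
              have zn: "pre z n = pre x n" using plays_pre[OF z] by simp
              have zD: "pre z k \<notin> D" if "length q < k" "k < n" for k
                using pre_eq_mono[OF zn, of k] n(3)[OF that] that by simp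
              have "z \<in> plays M' (pre x n)"
                using z first[of n z] n zn zD by (auto simp: plays_def)
              then have "z \<in> plays M' q" by (rule graft)
              moreover have "follows I \<sigma> (pre x n) z"
                using fz zn by (auto simp: follows_def \<sigma>'_def take_pre min_absorb1)
              then have "follows I \<sigma> q z" using follows_graft[OF f _ zn] n(1) by simp
              ultimately show "z \<in> A" by (rule win)
            qed
            moreover have "\<not> bad (pre x n)"
              using fgood[of y n] graft[OF y(1)] n yx pre_eq_mono[OF yx] by simp
            ultimately show False using W by (auto simp: good_def)
          qed
          have "x \<in> plays M' q" using x step noD by (simp add: plays_def)
          then show "x \<in> Z" using win f by (auto simp: Z_def)
        qed simp
        then show False using nq by blast
      qed
    qed
    then show False using that by (auto simp: bad_def)
  qed
  have "\<not> bad p"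
  proof
    assume b: "bad p"
    \<comment> \<open>The start \<open>p\<close> is added to the bad positions of \<open>D\<close>
      because it need not lie in \<open>D\<close>; as a single prefix it cannot account for
      infinitely many visits.\<close>
    have "wins I M p A"
    proof (rule wins_infinitely_often[where X = "{q. bad q \<and> (q = p \<or> q \<in> D)}"])
      fix q assume "q \<in> {q. bad q \<and> (q = p \<or> q \<in> D)}"
      then have "wins I M q {x. x \<in> A \<or> (\<exists>n>length q. pre x n \<in> D \<and> bad (pre x n))}"
        using claim by simp
      then show "wins I M q {x. x \<in> A \<or> (\<exists>n>length q. pre x n \<in> {q. bad q \<and> (q = p \<or> q \<in> D)})}"
        unfolding wins_def by fast
    next
      fix x assume inf: "\<exists>\<^sub>\<infinity>n. pre x n \<in> {q. bad q \<and> (q = p \<or> q \<in> D)}"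
      have "\<exists>n>m. pre x n \<in> D" for m
      proof -
        obtain n where "n > max m (length p)" "pre x n = p \<or> pre x n \<in> D"
          using inf[unfolded INFM_nat, rule_format, of "max m (length p)"] by auto
        then show ?thesis by (metis length_pre max_less_iff_conj less_irrefl)
      qed
      then show "x \<in> A" using DA by (simp add: INFM_nat)
    qed (use b ne in auto)
    then show False using nw by blast
  qed
  then show ?thesis by (auto simp: bad_def good_def)
qed

text \<open>The \<open>\<Sigma>\<^sup>0\<^sub>3\<close> sets of the product topology: the inner sets are the general \<open>G\<^sub>\<delta>\<close> sets.\<close>

definition sigma3 :: "(nat \<Rightarrow> 'v) set \<Rightarrow> bool" where
  "sigma3 A \<longleftrightarrow> (\<exists>D. A = {x. \<exists>n. \<exists>\<^sub>\<infinity>k. pre x k \<in> D (n::nat)})"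

text \<open>If \<open>A\<close> cannot be won, \<open>davis\<close> is applied at every step: after
  \<open>n\<close> moves the current restriction is thinned to exclude the \<open>n\<close>-th inner
  set while \<open>A\<close> stays unwon. The opponent moves inside the current restriction to a
  position still not won. The restrictions decrease, so the whole play lies in all of them and
  avoids every inner set.\<close>

theorem sigma3_determined:
  assumes ne: "\<forall>h. M h \<noteq> {}" and A: "sigma3 A"
  shows "wins I M p A \<or> wins (\<lambda>h. \<not> I h) M p (- A)"
proof (cases "wins I M p A")
  case False
  then have nw: "\<not> wins I M p A" .
  obtain D where D: "A = {x. \<exists>n. \<exists>\<^sub>\<infinity>k. pre x k \<in> D (n::nat)}" using A by (auto simp: sigma3_def)
  define Q where "Q N h M' \<longleftrightarrow> restricts I M' N \<and>
    (\<forall>x\<in>plays M' h. \<not> (\<exists>\<^sub>\<infinity>k. pre x k \<in> D (length h - length p))) \<and> \<not> wins I M' h A" for N h M'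
  have Q: "Q N h (SOME M'. Q N h M')" if "\<forall>h. N h \<noteq> {}" "\<not> wins I N h A" for N h
    using someI_ex[of "Q N h"] davis[OF that(1) _ that(2), of "D (length h - length p)"]
    by (auto simp: D Q_def)
  \<comment> \<open>\<open>R n h\<close> is meant for histories \<open>h\<close> with
    \<open>n\<close> letters beyond \<open>p\<close>; \<open>butlast\<close> passes to the parent,
    so each restriction depends on the history alone.\<close>
  define R where "R = rec_nat (\<lambda>h. SOME M'. Q M p M')
     (\<lambda>n f h. SOME M'. Q (f (butlast h)) h M')"
  define N where "N h = R (length h - length p) h" for h
  have Np: "N p = (SOME M'. Q M p M')" by (simp add: N_def R_def)
  have NS: "N (h @ [u]) = (SOME M'. Q (N h) (h @ [u]) M')" if "length p \<le> length h" for h u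
    using that by (simp add: N_def R_def Suc_diff_le)
  \<comment> \<open>Intersecting with \<open>M h\<close> makes \<open>\<tau>\<close> legal at all
    histories, even where \<open>N h\<close> is an unspecified choice.\<close>
  define \<tau> where "\<tau> h = (if \<exists>u\<in>N h h \<inter> M h. \<not> wins I (N h) (h @ [u]) A
    then SOME u. u \<in> N h h \<inter> M h \<and> \<not> wins I (N h) (h @ [u]) A else SOME u. u \<in> M h)" for h
  have \<tau>M: "\<tau> h \<in> M h" for h
  proof (cases "\<exists>u\<in>N h h \<inter> M h. \<not> wins I (N h) (h @ [u]) A")
    case True
    then show ?thesis using someI_ex[of "\<lambda>u. u \<in> N h h \<inter> M h \<and> \<not> wins I (N h) (h @ [u]) A"]
      by (auto simp: \<tau>_def)
  next
    case False then show ?thesis using ne by (simp only: \<tau>_def if_False some_in_eq) simp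
  qed
  have "wins (\<lambda>h. \<not> I h) M p (- A)"
    unfolding wins_def
  proof (intro exI conjI ballI impI)
    show "\<forall>h. \<tau> h \<in> M h" using \<tau>M by blast
    fix x assume x: "x \<in> plays M p" and f: "follows (\<lambda>h. \<not> I h) \<tau> p x"
    define h where "h n = pre x (length p + n)" for n
    have hS: "h (Suc n) = h n @ [x (length p + n)]" for n by (simp add: h_def pre_Suc)
    have lh: "length (h n) = length p + n" for n by (simp add: h_def)
    have h0: "h 0 = p" using plays_pre[OF x] by (simp add: h_def)
    have child: "x (length p + n) \<in> N (h n) (h n) \<and> \<not> wins I (N (h n)) (h (Suc n)) A"
      if r: "restricts I (N (h n)) M" and w: "\<not> wins I (N (h n)) (h n) A" for n
    proof (cases "I (h n)")
      case True
      have "x (length p + n) \<in> N (h n) (h n)"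
        using x r True by (auto simp: plays_def restricts_def h_def)
      then show ?thesis using wins_own_move[of I "h n" "x (length p + n)" "N (h n)" A] True w
        by (auto simp: hS)
    next
      case False
      obtain u where "u \<in> N (h n) (h n)" "\<not> wins I (N (h n)) (h n @ [u]) A"
        using wins_all_moves[of "N (h n)" "h n" I A] w r by (auto simp: restricts_def)
      moreover have "u \<in> M (h n)" using calculation r by (auto simp: restricts_def)
      ultimately have ex: "\<exists>u. u \<in> N (h n) (h n) \<inter> M (h n) \<and> \<not> wins I (N (h n)) (h n @ [u]) A"
        by blast
      have "x (length p + n) = \<tau> (h n)" using f False by (auto simp: follows_def h_def)
      also have "\<dots> = (SOME u. u \<in> N (h n) (h n) \<inter> M (h n) \<and> \<not> wins I (N (h n)) (h n @ [u]) A)"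
        using ex by (auto simp: \<tau>_def)
      finally show ?thesis using someI_ex[OF ex] by (simp add: hS)
    qed
    have inv: "restricts I (N (h n)) M \<and> \<not> wins I (N (h n)) (h n) A \<and>
       (\<forall>x\<in>plays (N (h n)) (h n). \<not> (\<exists>\<^sub>\<infinity>k. pre x k \<in> D n))" for n
    proof (induction n)
      case 0
      show ?case using Q[OF ne nw] by (simp add: h0 Np) (simp add: Q_def)
    next
      case (Suc n)
      have "Q (N (h n)) (h (Suc n)) (N (h (Suc n)))"
        unfolding hS using NS[of "h n"] Q[of "N (h n)"] Suc child[of n]
        by (simp add: lh hS restricts_def)
      then show ?case using Suc restricts_trans by (auto simp: Q_def lh)
    qed
    have sub: "N (h (n + k)) g \<subseteq> N (h n) g" for n k g
    proof (induction k)
      case (Suc k)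
      have "Q (N (h (n + k))) (h (Suc (n + k))) (N (h (Suc (n + k))))"
        unfolding hS using NS[of "h (n + k)"] Q[of "N (h (n + k))"] inv[of "n + k"] child[of "n + k"]
        by (simp add: lh hS restricts_def)
      then show ?case using Suc by (fastforce simp: Q_def restricts_def)
    qed simp
    have "x \<in> plays (N (h n)) (h n)" for n
    proof -
      have "x m \<in> N (h n) (pre x m)" if mn: "length p + n \<le> m" for m
      proof -
        obtain k where k: "m = length p + (n + k)" using mn by (auto simp: le_iff_add add.assoc)
        then have "x m \<in> N (h (n + k)) (h (n + k))" using child inv by blast
        then show ?thesis using sub[of n k] k by (auto simp: h_def)
      qed
      then show ?thesis by (simp add: plays_def h_def)
    qed
    then show "x \<in> - A" using inv by (auto simp: D)
  qed
  then show ?thesis ..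
qed simp

section \<open>Regular languages are \<open>\<Sigma>\<^sup>0\<^sub>3\<close>\<close>

lemma sigma3_empty: "sigma3 {}"
  unfolding sigma3_def by (rule exI[of _ "\<lambda>_. {}"]) simp

lemma sigma3_UNIV: "sigma3 UNIV"
  unfolding sigma3_def by (rule exI[of _ "\<lambda>_. UNIV"]) simp

lemma sigma3_Union:
  assumes "\<And>k::nat. sigma3 (A k)"
  shows "sigma3 (\<Union>k. A k)"
proof -
  obtain D where D: "\<And>k. A k = {x. \<exists>n. \<exists>\<^sub>\<infinity>t. pre x t \<in> D k (n::nat)}"
    using assms unfolding sigma3_def by metis
  define D' where "D' n = (case prod_decode n of (k, m) \<Rightarrow> D k m)" for n
  have "(\<Union>k. A k) = {x. \<exists>n. \<exists>\<^sub>\<infinity>t. pre x t \<in> D' n}" (is "?l = ?r")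
  proof (intro set_eqI iffI)
    fix x assume "x \<in> ?l"
    then obtain k n where "\<exists>\<^sub>\<infinity>t. pre x t \<in> D k n" by (auto simp: D)
    then have "\<exists>\<^sub>\<infinity>t. pre x t \<in> D' (prod_encode (k, n))" by (simp add: D'_def)
    then show "x \<in> ?r" by blast
  next
    fix x assume "x \<in> ?r"
    then obtain n where n: "\<exists>\<^sub>\<infinity>t. pre x t \<in> D' n" by blast
    obtain k m where "prod_decode n = (k, m)" by fastforce
    then have "\<exists>\<^sub>\<infinity>t. pre x t \<in> D k m" using n by (simp add: D'_def)
    then show "x \<in> ?l" by (auto simp: D)
  qed
  then show ?thesis unfolding sigma3_def by blast
qed

section \<open>Finite types of word segments\<close>

text \<open>This represents the class of a segment under Buechi's congruence. The right end is left
  out of the acceptance flag so that adjacent segments partition the positions.\<close>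

definition run_types ::
  "(nat \<times> 'v \<times> nat) set \<Rightarrow> nat set \<Rightarrow> (nat \<Rightarrow> 'v) \<Rightarrow> nat \<Rightarrow> nat \<Rightarrow> (nat \<times> nat \<times> bool) set" where
  "run_types \<delta> F x i j =
     {(r i, r j, \<exists>k\<in>{i..<j}. r k \<in> F) | r. \<forall>k\<in>{i..<j}. (r k, x k, r (Suc k)) \<in> \<delta>}"

lemma run_types_cong:
  assumes "\<And>k. i \<le> k \<Longrightarrow> k < j \<Longrightarrow> x k = y k"
  shows "run_types \<delta> F x i j = run_types \<delta> F y i j"
  using assms by (simp add: run_types_def)

lemma run_types_pre: "j \<le> t \<Longrightarrow> run_types \<delta> F (nth (pre x t)) i j = run_types \<delta> F x i j"
  by (rule run_types_cong) (simp add: nth_pre)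

text \<open>A nonempty segment has a transition at each end, which puts both end states in
  \<open>Q\<close>; an empty one would contribute a triple for every natural number, hence
  \<open>i < j\<close>.\<close>

lemma finite_run_types:
  assumes "finite Q" "\<delta> \<subseteq> Q \<times> V \<times> Q"
  shows "finite {run_types \<delta> F x i j | i j. i < j}"
proof (rule finite_subset)
  show "{run_types \<delta> F x i j | i j. i < j} \<subseteq> Pow (Q \<times> Q \<times> UNIV)"
  proof (intro subsetI PowI)
    fix A a assume "A \<in> {run_types \<delta> F x i j | i j. i < j}" and aA: "a \<in> A"
    then obtain i j where ij: "i < j" and A: "A = run_types \<delta> F x i j" by blast
    obtain r where r: "a = (r i, r j, \<exists>k\<in>{i..<j}. r k \<in> F)"
      "\<forall>k\<in>{i..<j}. (r k, x k, r (Suc k)) \<in> \<delta>"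
      using aA unfolding A run_types_def by blast
    have "(r i, x i, r (Suc i)) \<in> \<delta>" using r(2) ij by simp
    moreover have "(r (j - 1), x (j - 1), r (Suc (j - 1))) \<in> \<delta>"
      by (rule r(2)[rule_format]) (use ij in auto)
    ultimately show "a \<in> Q \<times> Q \<times> UNIV" using ij r(1) assms(2) by auto
  qed
  show "finite (Pow (Q \<times> Q \<times> (UNIV :: bool set)))" using assms(1) by simp
qed

lemma run_types_append:
  assumes "i \<le> j" "j \<le> k"
  shows "run_types \<delta> F x i k = {(p, s, b \<or> c) | p q s b c.
     (p, q, b) \<in> run_types \<delta> F x i j \<and> (q, s, c) \<in> run_types \<delta> F x j k}" (is "?l = ?r")
proof
  show "?l \<subseteq> ?r"
  proof
    fix a assume "a \<in> ?l"
    then obtain r where r: "a = (r i, r k, \<exists>l\<in>{i..<k}. r l \<in> F)"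
      "\<forall>l\<in>{i..<k}. (r l, x l, r (Suc l)) \<in> \<delta>" by (auto simp: run_types_def)
    have sp: "{i..<k} = {i..<j} \<union> {j..<k}" using assms by auto
    have "(r i, r j, \<exists>l\<in>{i..<j}. r l \<in> F) \<in> run_types \<delta> F x i j"
      "(r j, r k, \<exists>l\<in>{j..<k}. r l \<in> F) \<in> run_types \<delta> F x j k"
      using r(2) unfolding run_types_def sp by blast+
    moreover have "a = (r i, r k, (\<exists>l\<in>{i..<j}. r l \<in> F) \<or> (\<exists>l\<in>{j..<k}. r l \<in> F))"
      unfolding r(1) sp by blast
    ultimately show "a \<in> ?r" by blast
  qed
  show "?r \<subseteq> ?l"
  proof
    fix a assume "a \<in> ?r"
    then obtain p q s b c where a: "a = (p, s, b \<or> c)"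
      "(p, q, b) \<in> run_types \<delta> F x i j" "(q, s, c) \<in> run_types \<delta> F x j k" by blast
    obtain r where 1: "p = r i" "q = r j" "b = (\<exists>l\<in>{i..<j}. r l \<in> F)"
      "\<forall>l\<in>{i..<j}. (r l, x l, r (Suc l)) \<in> \<delta>"
      using a(2) by (auto simp: run_types_def)
    obtain r' where 2: "q = r' j" "s = r' k" "c = (\<exists>l\<in>{j..<k}. r' l \<in> F)"
      "\<forall>l\<in>{j..<k}. (r' l, x l, r' (Suc l)) \<in> \<delta>"
      using a(3) by (auto simp: run_types_def)
    have r: "r j = r' j"
      "a = (r i, r' k, (\<exists>l\<in>{i..<j}. r l \<in> F) \<or> (\<exists>l\<in>{j..<k}. r' l \<in> F))"
      "\<forall>l\<in>{i..<j}. (r l, x l, r (Suc l)) \<in> \<delta>" "\<forall>l\<in>{j..<k}. (r' l, x l, r' (Suc l)) \<in> \<delta>"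
      using a(1) 1 2 by simp_all
    define R where "R l = (if l < j then r l else r' l)" for l
    have R: "R l = r l" if "l \<le> j" for l using that r(1) by (cases "l = j") (auto simp: R_def)
    have R': "R l = r' l" if "j \<le> l" for l using that by (simp add: R_def)
    have "(R l, x l, R (Suc l)) \<in> \<delta>" if "i \<le> l" "l < k" for l
      using r(3,4) that R R' by (cases "l < j") auto
    moreover have "(\<exists>l\<in>{i..<k}. R l \<in> F) \<longleftrightarrow> (\<exists>l\<in>{i..<j}. r l \<in> F) \<or> (\<exists>l\<in>{j..<k}. r' l \<in> F)"
    proof -
      have "{i..<k} = {i..<j} \<union> {j..<k}" using assms by auto
      moreover have "(\<exists>l\<in>{i..<j}. R l \<in> F) \<longleftrightarrow> (\<exists>l\<in>{i..<j}. r l \<in> F)"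
        using R by auto
      moreover have "(\<exists>l\<in>{j..<k}. R l \<in> F) \<longleftrightarrow> (\<exists>l\<in>{j..<k}. r' l \<in> F)"
        using R' by auto
      ultimately show ?thesis by (simp only: bex_Un)
    qed
    moreover have "R i = r i" "R k = r' k" using R R' assms by auto
    ultimately show "a \<in> ?l" unfolding run_types_def
      by (intro CollectI exI[of _ R]) (simp add: r(2))
  qed
qed

text \<open>Both sides compose the same type up to \<open>k\<close> with the type from
  \<open>k\<close> to \<open>l\<close>; this is why merging is permanent.\<close>

lemma run_types_merge:
  assumes "run_types \<delta> F x i k = run_types \<delta> F x j k" "i \<le> k" "j \<le> k" "k \<le> l"
  shows "run_types \<delta> F x i l = run_types \<delta> F x j l"
  unfolding run_types_append[OF assms(2,4)] run_types_append[OF assms(3,4)] assms(1) ..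

lemma strict_mono_segment:
  fixes g :: "nat \<Rightarrow> nat"
  assumes "strict_mono g" "g 0 = 0"
  obtains i where "g i \<le> k" "k < g (Suc i)"
proof -
  have ex: "k < g (Suc k)" using strict_mono_imp_increasing[OF assms(1), of "Suc k"] by simp
  define i where "i = (LEAST i. k < g (Suc i))"
  have "k < g (Suc i)" unfolding i_def by (rule LeastI[of "\<lambda>i. k < g (Suc i)"]) (rule ex)
  moreover have "g i \<le> k"
  proof (cases i)
    case 0 then show ?thesis using assms(2) by simp
  next
    case (Suc j)
    then show ?thesis using not_less_Least[of j "\<lambda>i. k < g (Suc i)"] by (simp add: i_def)
  qed
  ultimately show ?thesis using that by blast
qed

lemma strict_mono_segment_unique:
  fixes g :: "nat \<Rightarrow> nat"
  assumes "strict_mono g" "g i \<le> k" "k < g (Suc i)" "g j \<le> k" "k < g (Suc j)"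
  shows "i = j"
proof -
  have "g i < g (Suc j)" "g j < g (Suc i)" using assms by linarith+
  then show ?thesis using strict_mono_less[OF assms(1)] by simp
qed

text \<open>An accepting run on \<open>y\<close> is cut at the points of \<open>g'\<close>; each
  piece is replaced by a run on the matching segment of \<open>x\<close> with the same end states
  and acceptance flag, so the pieces fit together and infinitely many of them still accept.\<close>

lemma buchi_lang_transfer:
  assumes y: "y \<in> buchi_lang V Q Q0 \<delta> F" and \<delta>: "\<delta> \<subseteq> Q \<times> V \<times> Q"
    and g: "strict_mono g" "g 0 = 0" and g': "strict_mono g'" "g' 0 = 0"
    and eq: "\<And>i. run_types \<delta> F x (g i) (g (Suc i)) = run_types \<delta> F y (g' i) (g' (Suc i))"
  shows "x \<in> buchi_lang V Q Q0 \<delta> F"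
proof -
  obtain r where r: "r 0 \<in> Q0" "\<And>n. (r n, y n, r (Suc n)) \<in> \<delta>" "\<exists>\<^sub>\<infinity>n. r n \<in> F"
    using y by (auto simp: buchi_lang_def)
  have "\<exists>\<rho>. \<rho> (g i) = r (g' i) \<and> \<rho> (g (Suc i)) = r (g' (Suc i)) \<and>
     (\<forall>k\<in>{g i..<g (Suc i)}. (\<rho> k, x k, \<rho> (Suc k)) \<in> \<delta>) \<and>
     ((\<exists>k\<in>{g i..<g (Suc i)}. \<rho> k \<in> F) \<longleftrightarrow> (\<exists>k\<in>{g' i..<g' (Suc i)}. r k \<in> F))" for i
  proof -
    have "(r (g' i), r (g' (Suc i)), \<exists>k\<in>{g' i..<g' (Suc i)}. r k \<in> F)
        \<in> run_types \<delta> F y (g' i) (g' (Suc i))"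
      using r(2) by (auto simp: run_types_def)
    then have "(r (g' i), r (g' (Suc i)), \<exists>k\<in>{g' i..<g' (Suc i)}. r k \<in> F)
        \<in> run_types \<delta> F x (g i) (g (Suc i))" by (simp only: eq)
    then show ?thesis by (auto simp: run_types_def)
  qed
  then obtain \<rho> where \<rho>: "\<And>i. \<rho> i (g i) = r (g' i)" "\<And>i. \<rho> i (g (Suc i)) = r (g' (Suc i))"
     "\<And>i k. g i \<le> k \<Longrightarrow> k < g (Suc i) \<Longrightarrow> (\<rho> i k, x k, \<rho> i (Suc k)) \<in> \<delta>"
     "\<And>i. (\<exists>k\<in>{g i..<g (Suc i)}. \<rho> i k \<in> F) \<longleftrightarrow> (\<exists>k\<in>{g' i..<g' (Suc i)}. r k \<in> F)"
    by (metis atLeastLessThan_iff)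
  define seg where "seg k = (THE i. g i \<le> k \<and> k < g (Suc i))" for k
  have seg: "seg k = i" if "g i \<le> k" "k < g (Suc i)" for k i
    unfolding seg_def using that strict_mono_segment_unique[OF g(1)] by blast
  define R where "R k = \<rho> (seg k) k" for k
  have R: "R k = \<rho> i k" if "g i \<le> k" "k \<le> g (Suc i)" for k i
  proof (cases "k < g (Suc i)")
    case True then show ?thesis using seg that by (simp add: R_def)
  next
    case False
    then have k: "k = g (Suc i)" using that by simp
    moreover have "g (Suc i) < g (Suc (Suc i))" using g(1) by (simp add: strict_mono_less)
    ultimately show ?thesis using seg[of "Suc i" k] \<rho> by (simp add: R_def)
  qed
  have tr: "(R k, x k, R (Suc k)) \<in> \<delta>" for k
  proof -
    obtain i where i: "g i \<le> k" "k < g (Suc i)" using strict_mono_segment[OF g] by blast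
    then show ?thesis using \<rho>(3)[OF i] R[of i k] R[of i "Suc k"] by simp
  qed
  have "R 0 = r 0" using R[of 0 0] \<rho>(1)[of 0] g g' by simp
  moreover have "\<exists>n\<ge>m. R n \<in> F" for m
  proof -
    obtain n where n: "n \<ge> g' m" "r n \<in> F" using r(3) by (auto simp: INFM_nat_le)
    obtain i where i: "g' i \<le> n" "n < g' (Suc i)" using strict_mono_segment[OF g'] by blast
    have "g' m < g' (Suc i)" using n i by simp
    then have "m \<le> i" using strict_mono_less[OF g'(1)] by simp
    obtain k where k: "g i \<le> k" "k < g (Suc i)" "\<rho> i k \<in> F" using \<rho>(4)[of i] i n by auto
    have "m \<le> k" using \<open>m \<le> i\<close> strict_mono_imp_increasing[OF g(1), of i] k(1) by linarith
    moreover have "R k \<in> F" using R[of i k] k by simp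
    ultimately show ?thesis by blast
  qed
  then have "\<exists>\<^sub>\<infinity>n. R n \<in> F" by (simp add: INFM_nat_le)
  moreover have "x n \<in> V" "R n \<in> Q" for n using tr[of n] \<delta> by auto
  ultimately show ?thesis using tr r(1) unfolding buchi_lang_def omega_words_def
    by (auto intro!: exI[of _ R])
qed

text \<open>McNaughton's observation: two positions \<open>n < m\<close> of a word merge once their segments have the
  same type, and from then on they stay merged. Hence \<open>x\<close> factorises into segments of type \<open>e\<close> from
  position \<open>n\<close> on as soon as infinitely many \<open>m\<close> with a segment of type \<open>e\<close> between \<open>n\<close> and \<open>m\<close>
  merge with \<open>n\<close>.\<close>

lemma sigma3_buchi_lang:
  assumes Q: "finite Q" and \<delta>: "\<delta> \<subseteq> Q \<times> V \<times> Q"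
  shows "sigma3 (buchi_lang V Q Q0 \<delta> F)"
proof -
  define L where "L = buchi_lang V Q Q0 \<delta> F"
  define T where "T = run_types \<delta> F"
  \<comment> \<open>Some word of \<open>L\<close> factorises into type \<open>s\<close> followed by
    \<open>e\<close> forever; by \<open>buchi_lang_transfer\<close> every word with such a
    factorisation then belongs to \<open>L\<close>.\<close>
  define G where "G s e \<longleftrightarrow> (\<exists>y\<in>L. \<exists>g::nat\<Rightarrow>nat. strict_mono g \<and> g 0 = 0 \<and> T y 0 (g 1) = s \<and>
     (\<forall>i\<ge>1. T y (g i) (g (Suc i)) = e))" for s e
  define mg where "mg x n m k \<longleftrightarrow> m < k \<and> T x n k = T x m k" for x n m k
  \<comment> \<open>Merging persists, so a single merged \<open>m\<close> would already count at all
    later times. First merge times avoid this: each \<open>m\<close> has at most one, so infinitely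
    many times require infinitely many \<open>m\<close>.\<close>
  define fm where "fm x n m t \<longleftrightarrow> mg x n m t \<and> (\<forall>k<t. \<not> mg x n m k)" for x n m t
  \<comment> \<open>\<open>0 < n\<close> makes the initial segment nonempty, as a strictly
    increasing sequence of cut points from 0 requires.\<close>
  define D where "D n = {h. 0 < n \<and> (\<exists>m>n. fm (nth h) n m (length h) \<and>
     G (T (nth h) 0 n) (T (nth h) n m))}" for n
  have Tpre: "T (nth (pre x t)) i j = T x i j" if "j \<le> t" for x t i j
    using that by (simp add: T_def run_types_pre)
  have mgpre: "mg (nth (pre x t)) n m k \<longleftrightarrow> mg x n m k" if "k \<le> t" for x t n m k
    using that by (simp add: mg_def Tpre)
  have fmpre: "fm (nth (pre x t)) n m t \<longleftrightarrow> fm x n m t" for x t n m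
    by (auto simp: fm_def mgpre)
  have Dpre: "pre x t \<in> D n \<longleftrightarrow> 0 < n \<and> (\<exists>m>n. fm x n m t \<and> G (T x 0 n) (T x n m))" for x t n
  proof -
    have "fm x n m t \<Longrightarrow> n < m \<Longrightarrow> n \<le> t \<and> m \<le> t" for m by (auto simp: fm_def mg_def)
    then show ?thesis unfolding D_def by (auto simp: fmpre Tpre)
  qed
  have "L = {x. \<exists>n. \<exists>\<^sub>\<infinity>t. pre x t \<in> D n}"
  proof (intro set_eqI iffI)
    fix x assume x: "x \<in> L"
    define C where "C = {T x i j | i j. i < j}"
    have finC: "finite C" unfolding C_def T_def by (rule finite_run_types[OF Q \<delta>])
    obtain code :: "_ \<Rightarrow> nat" and s where code: "code ` C = {i. i < s}" "inj_on code C"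
      by (rule finite_imp_inj_to_nat_seg[OF finC, THEN exE]) (elim exE conjE, rule that)
    have TC: "T x i j \<in> C" if "i < j" for i j using that by (auto simp: C_def)
    \<comment> \<open>Pairs of positive positions are coloured by the type of the segment between
      them; \<open>code\<close> turns the finitely many types into the numeric colours of
      \<open>Ramsey2\<close>.\<close>
    have ramsey: "\<exists>Y t. Y \<subseteq> {0<..} \<and> infinite Y \<and> t < s \<and>
        (\<forall>i\<in>Y. \<forall>j\<in>Y. i \<noteq> j \<longrightarrow> code (T x (Min {i, j}) (Max {i, j})) = t)"
    proof (rule Ramsey2[where f = "\<lambda>A. code (T x (Min A) (Max A))"])
      show "infinite {0::nat<..}" by (rule infinite_Ioi)
      show "\<forall>i\<in>{0<..}. \<forall>j\<in>{0<..}. i \<noteq> j \<longrightarrow> code (T x (Min {i, j}) (Max {i, j})) < s"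
      proof (intro ballI impI)
        fix i j :: nat assume "i \<noteq> j"
        then have "T x (Min {i, j}) (Max {i, j}) \<in> C" by (intro TC) auto
        then show "code (T x (Min {i, j}) (Max {i, j})) < s" using code(1) by blast
      qed
    qed
    obtain Y t where Y: "Y \<subseteq> {0<..}" "infinite Y"
      "\<forall>i\<in>Y. \<forall>j\<in>Y. i \<noteq> j \<longrightarrow> code (T x (Min {i, j}) (Max {i, j})) = t"
      using ramsey by (elim exE conjE) (rule that)
    have Yt: "code (T x i j) = t" if "i \<in> Y" "j \<in> Y" "i < j" for i j
      using Y(3)[rule_format, of i j] that by simp
    define n where "n = enumerate Y 0"
    define e where "e = T x n (enumerate Y 1)"
    have enY: "enumerate Y i \<in> Y" for i by (rule enumerate_in_set[OF Y(2)])
    have lt: "enumerate Y 0 < enumerate Y 1" by (rule enumerate_mono[OF _ Y(2)]) simp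
    have Ye: "T x i j = e" if "i \<in> Y" "j \<in> Y" "i < j" for i j
    proof (rule inj_onD[OF code(2)])
      show "code (T x i j) = code e" using Yt that lt enY by (simp add: e_def n_def)
      show "T x i j \<in> C" "e \<in> C" using TC that lt by (simp_all add: e_def n_def)
    qed
    have nY: "n \<in> Y" and n0: "0 < n" using enY[of 0] Y(1) by (auto simp: n_def)
    have "G (T x 0 n) e"
      unfolding G_def
    proof (intro bexI[OF _ x] exI conjI allI impI)
      define g where "g = case_nat 0 (enumerate Y)"
      show "strict_mono g"
        using n0 enumerate_mono[OF _ Y(2)]
        by (auto simp: strict_mono_Suc_iff g_def n_def split: nat.split)
      show "g 0 = 0" "T x 0 (g 1) = T x 0 n" by (simp_all add: g_def n_def)
      fix i :: nat assume "1 \<le> i"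
      then obtain j where "i = Suc j" by (cases i) auto
      then show "T x (g i) (g (Suc i)) = e"
        using Ye[OF enY enY, of j "Suc j"] enumerate_mono[OF _ Y(2), of j "Suc j"]
        by (simp add: g_def)
    qed
    have "\<exists>t>b. pre x t \<in> D n" for b
    proof -
      obtain m where m: "m \<in> Y" "m > max b n"
        using Y(2) unfolding infinite_nat_iff_unbounded by blast
      obtain k where k: "k \<in> Y" "k > m"
        using Y(2) unfolding infinite_nat_iff_unbounded by blast
      \<comment> \<open>All three positions lie in the homogeneous set, so both segments ending at
        \<open>k\<close> have type \<open>e\<close>. The first merge comes after \<open>m\<close>,
        hence after \<open>b\<close>.\<close>
      have "mg x n m k" using Ye[OF nY k(1)] Ye[OF m(1) k(1)] m k by (simp add: mg_def)
      then obtain l where l: "fm x n m l"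
        unfolding fm_def using LeastI[of "mg x n m" k] not_less_Least[of _ "mg x n m"] by blast
      moreover have "l > b" using l m unfolding fm_def mg_def by linarith
      moreover have "T x n m = e" using Ye nY m by simp
      ultimately show ?thesis using n0 \<open>G (T x 0 n) e\<close> m unfolding Dpre by auto
    qed
    then show "x \<in> {x. \<exists>n. \<exists>\<^sub>\<infinity>t. pre x t \<in> D n}" by (auto simp: INFM_nat)
  next
    fix x assume "x \<in> {x. \<exists>n. \<exists>\<^sub>\<infinity>t. pre x t \<in> D n}"
    then obtain n where inf: "infinite {t. pre x t \<in> D n}" by (auto simp: INFM_iff_infinite)
    then have "{t. pre x t \<in> D n} \<noteq> {}" by (metis finite.emptyI)
    then have n0: "0 < n" by (auto simp: Dpre)
    define M where "M = {m. n < m \<and> (\<exists>t. mg x n m t) \<and> G (T x 0 n) (T x n m)}"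
    have "{t. pre x t \<in> D n} \<subseteq> (\<lambda>m. LEAST t. mg x n m t) ` M"
    proof
      fix t assume "t \<in> {t. pre x t \<in> D n}"
      then obtain m where m: "n < m" "fm x n m t" "G (T x 0 n) (T x n m)" by (auto simp: Dpre)
      have "(LEAST t. mg x n m t) = t"
        by (rule Least_equality) (use m(2) in \<open>auto simp: fm_def not_less[symmetric]\<close>)
      moreover have "m \<in> M" using m by (auto simp: M_def fm_def)
      ultimately show "t \<in> (\<lambda>m. LEAST t. mg x n m t) ` M" by blast
    qed
    then have infM: "infinite M" using inf finite_surj by blast
    have "T x n ` M \<subseteq> {T x i j | i j. i < j}" by (auto simp: M_def)
    then have "finite (T x n ` M)"
      unfolding T_def using finite_run_types[OF Q \<delta>] by (rule finite_subset)
    then obtain m0 where m0: "m0 \<in> M" "infinite {m \<in> M. T x n m = T x n m0}"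
      using pigeonhole_infinite[OF infM] by blast
    define e where "e = T x n m0"
    define S where "S = {m \<in> M. T x n m = e}"
    have infS: "infinite S" using m0 by (simp add: S_def e_def)
    \<comment> \<open>Once \<open>a\<close> and \<open>n\<close> have merged at \<open>t\<close>, a
      later \<open>b\<close> in \<open>S\<close> sees the same type from \<open>a\<close> as from
      \<open>n\<close>, namely \<open>e\<close>.\<close>
    have nextS: "\<exists>b. b \<in> insert n S \<and> a < b \<and> T x a b = e" if a: "a \<in> insert n S" for a
    proof -
      obtain t where t: "a \<le> t" "n \<le> t" "T x n t = T x a t"
      proof (cases "a = n")
        case True then show ?thesis using that by blast
      next
        case False
        then have "a \<in> M" using a by (simp add: S_def)
        then obtain t where "n < a" "a < t" "T x n t = T x a t" by (auto simp: M_def mg_def)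
        then show ?thesis by (intro that[of t]) simp_all
      qed
      obtain b where b: "b \<in> S" "b > t"
        using infS unfolding infinite_nat_iff_unbounded by blast
      have "T x n b = T x a b"
        unfolding T_def by (rule run_types_merge[of _ _ _ _ t]) (use t b in \<open>auto simp: T_def\<close>)
      then show ?thesis using b t by (auto simp: S_def)
    qed
    have "\<exists>s. \<forall>k. ((k = 0 \<longrightarrow> s k = n) \<and> s k \<in> insert n S) \<and> (s k < s (Suc k) \<and> T x (s k) (s (Suc k)) = e)"
      by (rule dependent_nat_choice) (use nextS in auto)
    then obtain s where s: "s 0 = n" "\<And>k. s k < s (Suc k)" "\<And>k. T x (s k) (s (Suc k)) = e" by blast
    have "G (T x 0 n) e" using m0(1) by (simp add: M_def e_def)
    then obtain y g where y: "y \<in> L" "strict_mono g" "g 0 = 0" "T y 0 (g 1) = T x 0 n"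
      "\<And>i. i \<ge> 1 \<Longrightarrow> T y (g i) (g (Suc i)) = e" by (auto simp: G_def)
    have sm: "strict_mono (case_nat 0 s)"
      using s n0 by (auto simp: strict_mono_Suc_iff split: nat.split)
    show "x \<in> L"
      unfolding L_def
    proof (rule buchi_lang_transfer[OF y(1)[unfolded L_def] \<delta> sm _ y(2,3)])
      fix i
      show "run_types \<delta> F x (case_nat 0 s i) (case_nat 0 s (Suc i)) = run_types \<delta> F y (g i) (g (Suc i))"
        using y(3,4,5) s(1,3) unfolding T_def by (cases i) auto
    qed simp
  qed
  then show ?thesis unfolding sigma3_def L_def by blast
qed

section \<open>Integer payoffs from recognizable preorders\<close>

lemma omega_recognizable_rank:
  assumes R: "omega_recognizable V R" and tot: "total_preorder_on (omega_words V) R"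
  obtains r :: "(nat \<Rightarrow> 'v) \<Rightarrow> nat" and N where
    "\<And>x y. x \<in> omega_words V \<Longrightarrow> y \<in> omega_words V \<Longrightarrow> (x, y) \<in> R \<longleftrightarrow> r x \<le> r y"
    "\<And>x. r x \<le> N" "\<And>c. sigma3 {x. c \<le> r x}"
proof -
  obtain n X Y where XY: "\<And>k. k < n \<Longrightarrow> omega_regular V (X k)" "\<And>k. k < n \<Longrightarrow> omega_regular V (Y k)"
    "R = (\<Union>k<(n::nat). X k \<times> Y k)" using R by (auto simp: omega_recognizable_def)
  have regW: "L \<subseteq> omega_words V" if "omega_regular V L" for L
    using that by (auto simp: omega_regular_def buchi_lang_def)
  have reg3: "sigma3 L" if "omega_regular V L" for L
    using that sigma3_buchi_lang unfolding omega_regular_def by blast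
  define up where "up z = {y. (z, y) \<in> R}" for z
  \<comment> \<open>At most \<open>2 ^ n\<close> upper sets arise, one for each possible set of
    indices \<open>k\<close> with \<open>z \<in> X k\<close>.\<close>
  have up_eq: "up z = (\<Union>k. if k < n \<and> z \<in> X k then Y k else {})" for z
    by (auto simp: up_def XY(3) split: if_splits)
  have upW: "up z \<subseteq> omega_words V" for z
    using regW XY(2) by (fastforce simp: up_eq split: if_splits)
  have up3: "sigma3 (up z)" for z
    unfolding up_eq by (rule sigma3_Union) (simp add: reg3 XY(2) sigma3_empty)
  have refl: "(x, x) \<in> R" if "x \<in> omega_words V" for x
    using tot that by (simp add: total_preorder_on_def)
  have trans: "(x, z) \<in> R" if "(x, y) \<in> R" "(y, z) \<in> R" for x y z
    using tot that unfolding total_preorder_on_def by blast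
  have total: "(x, y) \<in> R \<or> (y, x) \<in> R" if "x \<in> omega_words V" "y \<in> omega_words V" for x y
    using tot that by (simp add: total_preorder_on_def)
  define U where "U = up ` omega_words V"
  have finU: "finite U"
  proof (rule finite_subset)
    show "U \<subseteq> (\<lambda>K. \<Union>k\<in>K. Y k) ` Pow {..<n}"
    proof
      fix u assume "u \<in> U"
      then obtain z where "u = up z" by (auto simp: U_def)
      then have "u = (\<Union>k\<in>{k. k < n \<and> z \<in> X k}. Y k)" by (auto simp: up_eq split: if_splits)
      then show "u \<in> (\<lambda>K. \<Union>k\<in>K. Y k) ` Pow {..<n}" by blast
    qed
  qed simp
  \<comment> \<open>The rank counts the upper sets containing \<open>x\<close>. It is strict because
    \<open>up x\<close> contains \<open>x\<close> but no word strictly below it. Words not over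
    \<open>V\<close> lie in no upper set and get rank 0.\<close>
  define r where "r x = card {u \<in> U. x \<in> u}" for x
  have mono: "r x \<le> r y" if "(x, y) \<in> R" for x y
    unfolding r_def
  proof (rule card_mono)
    show "{u \<in> U. x \<in> u} \<subseteq> {u \<in> U. y \<in> u}"
      using that trans by (auto simp: U_def up_def)
  qed (simp add: finU)
  have less: "r y < r x" if "x \<in> omega_words V" "y \<in> omega_words V" "(x, y) \<notin> R" for x y
    unfolding r_def
  proof (rule psubset_card_mono)
    have yx: "(y, x) \<in> R" using total that by blast
    have "{u \<in> U. y \<in> u} \<subseteq> {u \<in> U. x \<in> u}"
      using yx trans by (auto simp: U_def up_def)
    moreover have "up x \<in> {u \<in> U. x \<in> u} - {u \<in> U. y \<in> u}"
      using that refl by (auto simp: U_def up_def)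
    ultimately show "{u \<in> U. y \<in> u} \<subset> {u \<in> U. x \<in> u}" by blast
  qed (simp add: finU)
  have iff: "(x, y) \<in> R \<longleftrightarrow> r x \<le> r y" if "x \<in> omega_words V" "y \<in> omega_words V" for x y
    using mono less that by (meson not_le)
  have bound: "r x \<le> card U" for x
    unfolding r_def by (rule card_mono[OF finU]) simp
  have "sigma3 {x. c \<le> r x}" for c
  \<comment> \<open>For \<open>c = 0\<close> the level set also contains words not over
    \<open>V\<close>. A nonempty one with \<open>c > 0\<close> consists of words over
    \<open>V\<close> and is the upper set of any of its members of least rank.\<close>
  proof (cases "c = 0 \<or> {x. c \<le> r x} = {}")
    case True then show ?thesis using sigma3_UNIV sigma3_empty by auto
  next
    case False
    have W: "x \<in> omega_words V" if "c \<le> r x" for x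
    proof -
      have "r x \<noteq> 0" using that False by simp
      then have "{u \<in> U. x \<in> u} \<noteq> {}" by (metis r_def card.empty)
      then show ?thesis using upW by (auto simp: U_def)
    qed
    obtain z where z: "c \<le> r z" "\<And>x. c \<le> r x \<Longrightarrow> r z \<le> r x"
      using False ex_has_least_nat[of "\<lambda>x. c \<le> r x" _ r] by auto
    have "{x. c \<le> r x} = up z"
    proof (intro set_eqI iffI)
      fix x assume "x \<in> {x. c \<le> r x}"
      then show "x \<in> up z" using z iff[of z x] W by (simp add: up_def)
    next
      fix x assume "x \<in> up z"
      then show "x \<in> {x. c \<le> r x}" using z(1) mono[of z x] by (simp add: up_def)
    qed
    then show ?thesis using up3 by simp
  qed
  then show ?thesis using that iff bound by blast
qed

section \<open>Nash equilibria\<close>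

text \<open>The value \<open>UNIV\<close> at positions ending outside the arena only keeps the move sets nonempty.\<close>

definition moves :: "('v \<times> 'v) set \<Rightarrow> 'v list \<Rightarrow> 'v set" where
  "moves E h = (if \<exists>u. (last h, u) \<in> E then {u. (last h, u) \<in> E} else UNIV)"

abbreviation own :: "('v \<Rightarrow> 'p) \<Rightarrow> 'p \<Rightarrow> 'v list \<Rightarrow> bool" where
  "own owner i h \<equiv> owner (last h) = i"

lemma moves_nonempty: "moves E h \<noteq> {}"
  by (auto simp: moves_def)

lemma last_pre_Suc [simp]: "last (pre x (Suc n)) = x n"
  by (simp add: pre_Suc)

lemma plays_arena:
  assumes "arena V E P owner" "v0 \<in> V"
  shows "x \<in> plays (moves E) [v0] \<longleftrightarrow> x 0 = v0 \<and> (\<forall>n. (x n, x (Suc n)) \<in> E)"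
proof
  assume x: "x \<in> plays (moves E) [v0]"
  then have x0: "x 0 = v0" by (auto simp: plays_def pre_Suc)
  have st: "x (Suc n) \<in> moves E (pre x (Suc n))" for n using x by (simp add: plays_def)
  have V: "(x n, x (Suc n)) \<in> E" if "x n \<in> V" for n
  proof -
    have "\<exists>u. (x n, u) \<in> E" using that assms by (simp add: arena_def)
    then show ?thesis using st[of n] by (auto simp: moves_def)
  qed
  have "x n \<in> V" for n
    by (induction n) (use V x0 assms in \<open>auto simp: arena_def\<close>)
  then show "x 0 = v0 \<and> (\<forall>n. (x n, x (Suc n)) \<in> E)" using V x0 by blast
next
  assume "x 0 = v0 \<and> (\<forall>n. (x n, x (Suc n)) \<in> E)"
  moreover have "x n \<in> moves E (pre x n)" if "n \<ge> 1" "\<forall>n. (x n, x (Suc n)) \<in> E" for n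
    using that by (cases n) (auto simp: moves_def)
  ultimately show "x \<in> plays (moves E) [v0]" by (simp add: plays_def pre_Suc)
qed

lemma plays_arena_in_V:
  assumes "arena V E P owner" "v0 \<in> V" "x \<in> plays (moves E) [v0]"
  shows "x n \<in> V"
proof -
  have "(x n, x (Suc n)) \<in> E" using assms(3) plays_arena[OF assms(1,2)] by blast
  then show ?thesis using assms(1) by (auto simp: arena_def)
qed

lemma out_hist_eq_pre: "out_hist owner \<sigma> v0 n = pre (outcome owner \<sigma> v0) (Suc n)"
proof (induction n)
  case 0
  show ?case by (simp add: pre_Suc outcome_def)
next
  case (Suc n)
  have "outcome owner \<sigma> v0 (Suc n) = \<sigma> (owner (last (out_hist owner \<sigma> v0 n))) (out_hist owner \<sigma> v0 n)"
    by (simp add: outcome_def Let_def)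
  then show ?case using Suc by (simp add: pre_Suc[of _ "Suc n"] Let_def)
qed

lemma outcome_0: "outcome owner \<sigma> v0 0 = v0"
  by (simp add: outcome_def)

lemma outcome_Suc:
  "outcome owner \<sigma> v0 (Suc n) = \<sigma> (owner (outcome owner \<sigma> v0 n)) (pre (outcome owner \<sigma> v0) (Suc n))"
  unfolding out_hist_eq_pre[symmetric] by (simp add: outcome_def Let_def)

text \<open>Strategies are constrained only on histories, so the induction carries the fact that
  each prefix is a history, from which the legality of the next move follows.\<close>

lemma outcome_plays:
  assumes A: "arena V E P owner" and v0: "v0 \<in> V" and \<sigma>: "strategy_profile V E P owner \<sigma>"
  shows "outcome owner \<sigma> v0 \<in> plays (moves E) [v0]"
proof -
  define x where "x = outcome owner \<sigma> v0"
  have step: "(x n, x (Suc n)) \<in> E" if h: "history V E (pre x (Suc n))" for n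
  proof -
    have "x n \<in> V" using h by (auto simp: history_def pre_Suc)
    then have "strategy V E owner (owner (x n)) (\<sigma> (owner (x n)))"
      using A \<sigma> by (simp add: arena_def strategy_profile_def)
    then show ?thesis using h outcome_Suc[of owner \<sigma> v0 n]
      unfolding strategy_def x_def[symmetric] by force
  qed
  have hist: "history V E (pre x (Suc n))" for n
  proof (induction n)
    case 0
    show ?case using v0 by (simp add: history_def pre_Suc x_def outcome_0)
  next
    case (Suc n)
    have e: "(x n, x (Suc n)) \<in> E" using step[OF Suc] .
    have "x (Suc n) \<in> V" using e A by (auto simp: arena_def)
    then have "set (pre x (Suc (Suc n))) \<subseteq> V"
      using Suc by (simp add: history_def pre_Suc[of x "Suc n"])
    moreover have "(pre x (Suc (Suc n)) ! k, pre x (Suc (Suc n)) ! Suc k) \<in> E" if "Suc k < Suc (Suc n)" for k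
    proof (cases "k = n")
      case True then show ?thesis using e by (simp add: nth_pre)
    next
      case False
      then have "Suc k < length (pre x (Suc n))" using that by simp
      then have "(pre x (Suc n) ! k, pre x (Suc n) ! Suc k) \<in> E"
        using Suc unfolding history_def by blast
      then show ?thesis using False that by (simp add: nth_pre)
    qed
    ultimately show ?case by (simp add: history_def) (simp add: pre_Suc)
  qed
  show ?thesis unfolding plays_arena[OF A v0] using step[OF hist] by (simp add: x_def outcome_0)
qed

text \<open>Along an optimal play of player \<open>i\<close> the value of \<open>i\<close> never drops, while other players may
  raise it. From a history maximising the sum of all values among those that never let a value drop,
  playing optimally keeps every value constant. So the resulting play gives each player at least
  the value at each of its prefixes, which is all that a punished deviator can get.\<close>

lemma no_profitable_deviation:
  fixes r :: "'p \<Rightarrow> (nat \<Rightarrow> 'v) \<Rightarrow> nat"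
  assumes A: "arena V E P owner" and v0: "v0 \<in> V"
    and bound: "\<And>i x. i \<in> P \<Longrightarrow> r i x \<le> N i"
    and det: "\<And>i c p. i \<in> P \<Longrightarrow> wins (own owner i) (moves E) p {x. c \<le> r i x} \<or>
      wins (\<lambda>h. \<not> own owner i h) (moves E) p (- {x. c \<le> r i x})"
  shows "\<exists>\<sigma>. strategy_profile V E P owner \<sigma> \<and>
    (\<forall>i\<in>P. \<forall>\<tau>. strategy V E owner i \<tau> \<longrightarrow>
       r i (outcome owner (\<sigma>(i := \<tau>)) v0) \<le> r i (outcome owner \<sigma> v0))"
proof -
  let ?M = "moves E"
  have finP: "finite P" using A by (simp add: arena_def)
  have M0: "\<forall>h. (SOME u. u \<in> ?M h) \<in> ?M h" using moves_nonempty[of E] by (simp add: some_in_eq)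
  define win where "win i p c \<longleftrightarrow> wins (own owner i) ?M p {x. c \<le> r i x}" for i p c
  define val where "val i p = (GREATEST c. win i p c)" for i p
  have win0: "win i p 0" for i p
    unfolding win_def wins_def by (intro exI conjI) (rule M0, simp)
  have winN: "c \<le> N i" if i: "i \<in> P" and w: "win i p c" for i p c
  proof -
    obtain \<sigma> where \<sigma>: "\<forall>h. \<sigma> h \<in> ?M h"
      "\<And>x. x \<in> plays ?M p \<Longrightarrow> follows (own owner i) \<sigma> p x \<Longrightarrow> c \<le> r i x"
      using w by (auto simp: win_def wins_def)
    obtain x where "x \<in> plays ?M p" "\<forall>n\<ge>length p. x n = \<sigma> (pre x n)"
      using exists_play[OF \<sigma>(1)] by blast
    then have "c \<le> r i x" by (intro \<sigma>(2)) (auto simp: follows_def)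
    then show ?thesis using bound[OF i] le_trans by blast
  qed
  have val_win: "win i p (val i p)" if "i \<in> P" for i p
    unfolding val_def by (rule GreatestI_nat[of _ 0 "N i"]) (use win0 winN that in auto)
  have val_ge: "c \<le> val i p" if "i \<in> P" "win i p c" for i p c
    unfolding val_def by (rule Greatest_le_nat[of _ _ "N i"]) (use winN that in auto)
  have punish: "wins (\<lambda>h. \<not> own owner i h) ?M p {x. r i x \<le> val i p}" if "i \<in> P" for i p
  proof -
    have "\<not> win i p (Suc (val i p))" using val_ge[OF that, of p "Suc (val i p)"] by auto
    then have "wins (\<lambda>h. \<not> own owner i h) ?M p (- {x. Suc (val i p) \<le> r i x})"
      using det[OF that] by (auto simp: win_def)
    moreover have "- {x. Suc (val i p) \<le> r i x} = {x. r i x \<le> val i p}" by auto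
    ultimately show ?thesis by simp
  qed
  \<comment> \<open>A player's own move cannot raise the player's value, since what is secured after
    the move is secured before it.\<close>
  have val_child: "val i (h @ [u]) \<le> val i h" if "i \<in> P" "own owner i h" "u \<in> ?M h" for i h u
    using val_win[of i "h @ [u]"] wins_own_move[of "own owner i" h u ?M] that
    by (intro val_ge) (auto simp: win_def)
  \<comment> \<open>For indices outside \<open>P\<close> only legality is demanded:
    \<open>owner (last h)\<close> can be such an index when \<open>h\<close> ends outside the arena,
    and the joint strategy must be legal there too.\<close>
  define opt where "opt i p \<sigma> \<longleftrightarrow> (\<forall>h. \<sigma> h \<in> ?M h) \<and>
    (i \<in> P \<longrightarrow> (\<forall>x\<in>plays ?M p. follows (own owner i) \<sigma> p x \<longrightarrow> val i p \<le> r i x))" for i p \<sigma>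
  define pun where "pun i p \<sigma> \<longleftrightarrow> (\<forall>h. \<sigma> h \<in> ?M h) \<and>
    (i \<in> P \<longrightarrow> (\<forall>x\<in>plays ?M p. follows (\<lambda>h. \<not> own owner i h) \<sigma> p x \<longrightarrow> r i x \<le> val i p))" for i p \<sigma>
  define s where "s i p = (SOME \<sigma>. opt i p \<sigma>)" for i p
  define t where "t i p = (SOME \<sigma>. pun i p \<sigma>)" for i p
  have ex_opt: "\<exists>\<sigma>. opt i p \<sigma>" for i p
  proof (cases "i \<in> P")
    case True
    obtain \<sigma> where "\<forall>h. \<sigma> h \<in> ?M h"
      "\<forall>x\<in>plays ?M p. follows (own owner i) \<sigma> p x \<longrightarrow> x \<in> {x. val i p \<le> r i x}"
      using val_win[OF True, of p] unfolding win_def wins_def by (elim exE conjE) (rule that)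
    then have "opt i p \<sigma>" by (simp add: opt_def)
    then show ?thesis by blast
  next
    case False then show ?thesis unfolding opt_def using M0 by (intro exI conjI) simp_all
  qed
  have s: "opt i p (s i p)" for i p
    unfolding s_def by (rule someI_ex[OF ex_opt])
  have ex_pun: "\<exists>\<sigma>. pun i p \<sigma>" for i p
  proof (cases "i \<in> P")
    case True
    obtain \<sigma> where "\<forall>h. \<sigma> h \<in> ?M h"
      "\<forall>x\<in>plays ?M p. follows (\<lambda>h. \<not> own owner i h) \<sigma> p x \<longrightarrow> x \<in> {x. r i x \<le> val i p}"
      using punish[OF True, of p] unfolding wins_def by (elim exE conjE) (rule that)
    then have "pun i p \<sigma>" by (simp add: pun_def)
    then show ?thesis by blast
  next
    case False then show ?thesis unfolding pun_def using M0 by (intro exI conjI) simp_all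
  qed
  have t: "pun i p (t i p)" for i p
    unfolding t_def by (rule someI_ex[OF ex_pun])
  \<comment> \<open>The strategy securing the value at \<open>p\<close> secures it from every later
    prefix as well: a continuation following it, grafted onto the prefix, is a play from
    \<open>p\<close> following it.\<close>
  have val_keep: "val i p \<le> val i (pre x n)"
    if "i \<in> P" "x \<in> plays ?M p" "follows (own owner i) (s i p) p x" "length p \<le> n" for i p x n
  proof (rule val_ge[OF that(1)])
    show "win i (pre x n) (val i p)"
      unfolding win_def wins_def
    proof (intro exI[of _ "s i p"] conjI ballI impI)
      show "\<forall>h. s i p h \<in> ?M h" using s by (simp add: opt_def)
      fix y assume y: "y \<in> plays ?M (pre x n)" "follows (own owner i) (s i p) (pre x n) y"
      have "y \<in> plays ?M p" using plays_graft[OF that(2,4) y(1)] .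
      moreover have "follows (own owner i) (s i p) p y"
        using follows_graft[OF that(3,4) _ y(2)] plays_pre[OF y(1)] by simp
      ultimately show "y \<in> {y. val i p \<le> r i y}" using s[of i p] that(1) by (simp add: opt_def)
    qed
  qed
  \<comment> \<open>A history is coded as the first \<open>n\<close> letters of a play from
    \<open>v0\<close>. For each player its final value dominates all earlier ones, which later
    bounds the values at the prefixes of \<open>H\<close>.\<close>
  define C where "C = (\<lambda>(x, n). x \<in> plays ?M [v0] \<and> 1 \<le> n \<and>
    (\<forall>i\<in>P. \<forall>k. 1 \<le> k \<longrightarrow> k \<le> n \<longrightarrow> val i (pre x k) \<le> val i (pre x n)))"
  define f where "f = (\<lambda>(x, n). \<Sum>i\<in>P. val i (pre x n))"
  obtain x0 where x0: "x0 \<in> plays ?M [v0]" using exists_play[OF M0] by metis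
  have "C (x0, 1)" using x0 by (auto simp: C_def dest: le_antisym)
  moreover have "\<forall>y. C y \<longrightarrow> f y < Suc (\<Sum>i\<in>P. N i)"
    using winN[OF _ val_win] by (auto simp: f_def less_Suc_eq_le intro!: sum_mono)
  ultimately obtain y where y: "C y" "\<And>y'. C y' \<Longrightarrow> f y' \<le> f y"
    using Lattices_Big.ex_has_greatest_nat[of C "(x0, 1)" f] by blast
  obtain z l where "y = (z, l)" by fastforce
  then have z: "C (z, l)" "\<And>y'. C y' \<Longrightarrow> f y' \<le> f (z, l)" using y by auto
  have zp: "z \<in> plays ?M [v0]" and l: "1 \<le> l" using z(1) by (auto simp: C_def)
  define H where "H = pre z l"
  have lH: "length H = l" by (simp add: H_def)
  have "\<forall>h. s (owner (last h)) H h \<in> ?M h" using s by (simp add: opt_def)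
  then obtain \<rho> where \<rho>: "\<rho> \<in> plays ?M H" "\<forall>n\<ge>l. \<rho> n = s (owner (last (pre \<rho> n))) H (pre \<rho> n)"
    using exists_play[of "\<lambda>h. s (owner (last h)) H h" ?M H] lH by metis
  have \<rho>v0: "\<rho> \<in> plays ?M [v0]" using plays_graft[OF zp _ \<rho>(1)[unfolded H_def]] l by simp
  have \<rho>H: "pre \<rho> l = H" using plays_pre[OF \<rho>(1)] lH by simp
  have fol: "follows (own owner i) (s i H) H \<rho>" for i
    using \<rho>(2) by (auto simp: follows_def lH)
  \<comment> \<open>\<open>val_keep\<close> gives one inequality for every player and makes
    \<open>(\<rho>, n)\<close> a competitor in \<open>C\<close>; maximality of the sum then forces
    equality in each summand.\<close>
  have const: "\<forall>i\<in>P. val i (pre \<rho> n) = val i H" if "l \<le> n" for n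
    using that
  proof (induction n rule: less_induct)
    case (less n)
    have ge: "val i H \<le> val i (pre \<rho> n)" if "i \<in> P" for i
      using val_keep[OF that \<rho>(1) fol] less lH by simp
    have "val i (pre \<rho> k) \<le> val i (pre \<rho> n)" if "i \<in> P" "1 \<le> k" "k \<le> n" for i k
    proof (cases "k \<le> l")
      case True
      have "pre \<rho> k = pre z k" using pre_eq_mono[of \<rho> l z k] \<rho>H True by (simp add: H_def)
      then have "val i (pre \<rho> k) \<le> val i H" using z(1) that True by (simp add: C_def H_def)
      then show ?thesis using ge[OF that(1)] by simp
    next
      case False
      then show ?thesis using less.IH[of k] that ge[OF that(1)] by (cases "k = n") auto
    qed
    then have "C (\<rho>, n)" using \<rho>v0 l less by (simp add: C_def)
    then have "f (\<rho>, n) \<le> f (z, l)" by (rule z(2))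
    then have sums: "(\<Sum>i\<in>P. val i H) = (\<Sum>i\<in>P. val i (pre \<rho> n))"
      using ge sum_mono[of P "\<lambda>i. val i H" "\<lambda>i. val i (pre \<rho> n)"] by (simp add: f_def H_def)
    show ?case
    proof
      fix i assume "i \<in> P"
      show "val i (pre \<rho> n) = val i H"
        by (rule sum_mono_inv[OF sums ge \<open>i \<in> P\<close> finP, symmetric])
    qed
  qed
  have enough: "val i (pre \<rho> k) \<le> r i \<rho>" if "i \<in> P" "1 \<le> k" for i k
  proof -
    have "val i H \<le> r i \<rho>" using s[of i H] that(1) \<rho>(1) fol by (simp add: opt_def)
    moreover have "val i (pre \<rho> k) \<le> val i H"
    proof (cases "k \<le> l")
      case True
      have "pre \<rho> k = pre z k" using pre_eq_mono[of \<rho> l z k] \<rho>H True by (simp add: H_def)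
      then show ?thesis using z(1) that True by (simp add: C_def H_def)
    next
      case False then show ?thesis using const[of k] that by simp
    qed
    ultimately show ?thesis by simp
  qed
  \<comment> \<open>This is the length of the shortest prefix that has left \<open>\<rho>\<close>.
    The deviating move is its last letter, so the deviator owns the last vertex of the prefix of
    length \<open>dev h - 1\<close>; punishment starts after the move, from the prefix of length
    \<open>dev h\<close>.\<close>
  define dev where "dev h = (LEAST k. take k h \<noteq> pre \<rho> k)" for h
  define \<sigma> where "\<sigma> j h = (if h = pre \<rho> (length h) then \<rho> (length h)
    else t (owner (last (take (dev h - 1) h))) (take (dev h) h) h)" for j :: 'p and h
  have \<rho>E: "\<rho> 0 = v0" "\<And>n. (\<rho> n, \<rho> (Suc n)) \<in> E" using \<rho>v0 plays_arena[OF A v0] by auto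
  have prof: "strategy_profile V E P owner \<sigma>"
    unfolding strategy_profile_def strategy_def
  proof (intro ballI allI impI)
    fix i h assume h: "history V E h"
    then have "last h \<in> V" "h \<noteq> []" by (auto simp: history_def)
    then have ex: "\<exists>u. (last h, u) \<in> E" using A by (simp add: arena_def)
    show "(last h, \<sigma> i h) \<in> E"
    proof (cases "h = pre \<rho> (length h)")
      case True
      obtain n where n: "length h = Suc n" using \<open>h \<noteq> []\<close> by (cases h) auto
      have "last h = \<rho> n" using True n last_pre_Suc by metis
      then show ?thesis using True n \<rho>E(2) by (simp add: \<sigma>_def)
    next
      case False
      then have "\<sigma> i h \<in> ?M h" using t by (simp add: \<sigma>_def pun_def)
      then show ?thesis using ex by (simp add: moves_def)
    qed
  qed
  have out: "outcome owner \<sigma> v0 = \<rho>"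
  proof -
    have "pre (outcome owner \<sigma> v0) (Suc n) = pre \<rho> (Suc n)" for n
    proof (induction n)
      case 0 show ?case by (simp add: pre_Suc outcome_0 \<rho>E)
    next
      case (Suc n)
      have "outcome owner \<sigma> v0 (Suc n) = \<rho> (Suc n)"
        unfolding outcome_Suc Suc by (simp add: \<sigma>_def)
      then show ?case using Suc by (simp add: pre_Suc[of _ "Suc n"])
    qed
    then show ?thesis by (metis last_pre_Suc ext)
  qed
  have "r i (outcome owner (\<sigma>(i := \<tau>)) v0) \<le> r i \<rho>"
    if i: "i \<in> P" and \<tau>: "strategy V E owner i \<tau>" for i \<tau>
  proof -
    define y where "y = outcome owner (\<sigma>(i := \<tau>)) v0"
    have "strategy_profile V E P owner (\<sigma>(i := \<tau>))" using prof \<tau> by (simp add: strategy_profile_def)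
    then have yp: "y \<in> plays ?M [v0]" unfolding y_def by (rule outcome_plays[OF A v0])
    have y0: "y 0 = v0" and yE: "(y n, y (Suc n)) \<in> E" for n using yp plays_arena[OF A v0] by auto
    have yS: "y (Suc n) = (\<sigma>(i := \<tau>)) (owner (y n)) (pre y (Suc n))" for n
      unfolding y_def by (rule outcome_Suc)
    show ?thesis
    proof (cases "y = \<rho>")
      case True then show ?thesis by (simp add: y_def)
    next
      case False
      define d where "d = (LEAST k. y k \<noteq> \<rho> k)"
      have "\<exists>k. y k \<noteq> \<rho> k" using False by auto
      then have d: "y d \<noteq> \<rho> d" unfolding d_def by (rule LeastI_ex)
      have dmin: "y k = \<rho> k" if "k < d" for k using that not_less_Least unfolding d_def by blast
      have pd: "pre y k = pre \<rho> k" if "k \<le> d" for k using that dmin by (simp add: pre_eq_iff)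
      have "d \<noteq> 0" using d y0 \<rho>E(1) by metis
      then obtain d' where d': "d = Suc d'" by (cases d) auto
      \<comment> \<open>Everyone else still plays \<open>\<rho>\<close> at this prefix, so the first
        deviation is made by \<open>i\<close>.\<close>
      have oi: "owner (y d') = i"
      proof (rule ccontr)
        assume "owner (y d') \<noteq> i"
        then have "y d = \<sigma> (owner (y d')) (pre y d)" using yS d' by simp
        then show False using d pd[of d] by (simp add: \<sigma>_def)
      qed
      define p where "p = pre y (Suc d)"
      have lp: "length p = Suc d" by (simp add: p_def)
      have yp': "y \<in> plays ?M p" unfolding p_def by (rule plays_later[OF yp]) simp
      have devd: "dev (pre y n) = Suc d" if "Suc d \<le> n" for n
        unfolding dev_def
      proof (rule Least_equality)
        show "take (Suc d) (pre y n) \<noteq> pre \<rho> (Suc d)"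
          using that d by (simp add: take_pre min_absorb1 pre_Suc)
        fix k assume k: "take k (pre y n) \<noteq> pre \<rho> k"
        show "Suc d \<le> k"
        proof (rule ccontr)
          assume "\<not> Suc d \<le> k"
          then show False using k pd[of k] that by (simp add: take_pre min_absorb1)
        qed
      qed
      have "follows (\<lambda>h. \<not> own owner i h) (t i p) p y"
        unfolding follows_def
      proof (intro allI impI)
        fix n assume n: "length p \<le> n" "\<not> own owner i (pre y n)"
        then obtain m where m: "n = Suc m" using lp by (cases n) auto
        have "pre y n \<noteq> pre \<rho> n" using d n(1) lp by (auto simp: pre_eq_iff intro!: exI[of _ d])
        then have yn: "y n = t (owner (last (take d (pre y n)))) (take (Suc d) (pre y n)) (pre y n)"
          using yS[of m] n m devd[of n] lp by (simp add: \<sigma>_def)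
        have "take d (pre y n) = pre y (Suc d')" "take (Suc d) (pre y n) = p"
          using n(1) lp d' by (simp_all add: take_pre min_absorb1 p_def)
        then show "y n = t i p (pre y n)" using yn oi by simp
      qed
      \<comment> \<open>Punishment holds \<open>i\<close> to the value after the deviation, the
        deviating move did not raise that value, and the prefix before it lies on
        \<open>\<rho>\<close>, where \<open>enough\<close> applies.\<close>
      then have "r i y \<le> val i p" using t[of i p] i yp' by (simp add: pun_def)
      also have "p = pre y d @ [y d]" by (simp add: p_def pre_Suc)
      also have "val i \<dots> \<le> val i (pre y d)"
        by (rule val_child[OF i]) (use oi d' yE[of d'] in \<open>auto simp: moves_def\<close>)
      also have "\<dots> = val i (pre \<rho> d)" using pd by simp
      also have "\<dots> \<le> r i \<rho>" by (rule enough[OF i]) (simp add: d')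
      finally show ?thesis by (simp add: y_def)
    qed
  qed
  then show ?thesis using prof out by (intro exI[of _ \<sigma>]) simp
qed

theorem theorem18:
  fixes V :: "'v set" and E :: "('v \<times> 'v) set" and P :: "'p set" and owner :: "'v \<Rightarrow> 'p"
    and pref :: "'p \<Rightarrow> ((nat \<Rightarrow> 'v) \<times> (nat \<Rightarrow> 'v)) set"
  assumes "arena V E P owner"
    and "\<forall>i\<in>P. omega_recognizable V (pref i) \<and> total_preorder_on (omega_words V) (pref i)"
  shows "\<forall>v0\<in>V. \<exists>\<sigma>. nash_equilibrium V E P owner pref v0 \<sigma>"
proof
  fix v0 assume v0: "v0 \<in> V"
  define ranks where "ranks i f \<longleftrightarrow>
    (\<forall>x\<in>omega_words V. \<forall>y\<in>omega_words V. (x, y) \<in> pref i \<longleftrightarrow> fst f x \<le> fst f y) \<and>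
    (\<forall>x. fst f x \<le> snd f) \<and> (\<forall>c. sigma3 {x. c \<le> fst f x})"
    for i and f :: "((nat \<Rightarrow> 'v) \<Rightarrow> nat) \<times> nat"
  have "\<forall>i\<in>P. \<exists>f. ranks i f"
  proof
    fix i assume "i \<in> P"
    then have pref: "omega_recognizable V (pref i)" "total_preorder_on (omega_words V) (pref i)"
      using assms(2) by auto
    obtain r :: "(nat \<Rightarrow> 'v) \<Rightarrow> nat" and N where
      "\<And>x y. x \<in> omega_words V \<Longrightarrow> y \<in> omega_words V \<Longrightarrow> (x, y) \<in> pref i \<longleftrightarrow> r x \<le> r y"
      "\<And>x. r x \<le> N" "\<And>c. sigma3 {x. c \<le> r x}"
      by (rule omega_recognizable_rank[OF pref]) (rule that)
    then have "ranks i (r, N)" by (simp add: ranks_def)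
    then show "\<exists>f. ranks i f" ..
  qed
  from bchoice[OF this] obtain f where f: "\<forall>i\<in>P. ranks i (f i)" ..
  define r where "r i = fst (f i)" for i
  have r: "(x, y) \<in> pref i \<longleftrightarrow> r i x \<le> r i y"
    if "i \<in> P" "x \<in> omega_words V" "y \<in> omega_words V" for i x y
    using f that by (simp add: ranks_def r_def)
  have N: "r i x \<le> snd (f i)" and s3: "sigma3 {x. c \<le> r i x}" if "i \<in> P" for i x c
    using f that by (simp_all add: ranks_def r_def)
  have det: "wins (own owner i) (moves E) p {x. c \<le> r i x} \<or>
      wins (\<lambda>h. \<not> own owner i h) (moves E) p (- {x. c \<le> r i x})" if "i \<in> P" for i c p
    by (rule sigma3_determined) (use s3 that moves_nonempty in auto)
  obtain \<sigma> where \<sigma>: "strategy_profile V E P owner \<sigma>"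
    "\<And>i \<tau>. i \<in> P \<Longrightarrow> strategy V E owner i \<tau> \<Longrightarrow>
       r i (outcome owner (\<sigma>(i := \<tau>)) v0) \<le> r i (outcome owner \<sigma> v0)"
    using no_profitable_deviation[OF assms(1) v0 N det] by blast
  \<comment> \<open>The ranks represent the preferences only on words over \<open>V\<close>, so both
    outcomes must be shown to be such words.\<close>
  have W: "outcome owner \<sigma>' v0 \<in> omega_words V" if "strategy_profile V E P owner \<sigma>'" for \<sigma>'
    using plays_arena_in_V[OF assms(1) v0 outcome_plays[OF assms(1) v0 that]]
    by (simp add: omega_words_def)
  have "\<not> strict_pref (pref i) (outcome owner \<sigma> v0) (outcome owner (\<sigma>(i := \<tau>)) v0)"
    if i: "i \<in> P" and \<tau>: "strategy V E owner i \<tau>" for i \<tau>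
  proof -
    have "strategy_profile V E P owner (\<sigma>(i := \<tau>))"
      using \<sigma>(1) \<tau> by (simp add: strategy_profile_def)
    then have "(outcome owner (\<sigma>(i := \<tau>)) v0, outcome owner \<sigma> v0) \<in> pref i"
      using r[OF i W W] \<sigma>(1) \<sigma>(2)[OF i \<tau>] by blast
    then show ?thesis by (simp add: strict_pref_def)
  qed
  then show "\<exists>\<sigma>. nash_equilibrium V E P owner pref v0 \<sigma>"
    using \<sigma>(1) unfolding nash_equilibrium_def by blast
qed

end
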